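(* Let $S:X\rightrightarrows Y$ be a set-valued mapping between reflexive Banach spaces $X$ and $Y$, and let $\Omega\subset X$ and $\Theta\subset Y$ be closed and convex sets. Suppose that $(\bar x,\bar y)\in\operatorname{gph} S|_\Omega^\Theta$ and that the set $\operatorname{gph} S|_\Omega^\Theta$ is closed around $(\bar x,\bar y)$. Then the following assertions are equivalent: (i) $S$ is Lipschitz-like relative to $\Omega\times\Theta$ around $(\bar x,\bar y)$. (ii) $S$ is PSNC relative to $\Omega\times\Theta$ at $(\bar x,\bar y)$, and $|D_M^*S_\Omega^\Theta(\bar x|\bar y)|^+<\infty$. (iii) $S$ is PSNC relative to $\Omega\times\Theta$ at $(\bar x,\bar y)$, and $D_M^*S_\Omega^\Theta(\bar x|\bar y)(0)=\{0\}$. Moreover, under the fulfillment of (i)--(iii), the exact Lipschitzian bound of $S$ relative to $\Omega\times\Theta$ around $(\bar x,\bar y)$ satisfies the estimates $$|D_M^*S_\Omega^\Theta(\bar x|\bar y)|^+\le \operatorname{lip}_\Omega^\Theta S(\bar x,\bar y)\le |D_N^*S_\Omega^\Theta(\bar x|\bar y)|^+,$$ where the upper (second) estimate holds when $\dim X<\infty$. If (with $\dim X<\infty$) in addition $S$ is coderivatively normal relative to $\Omega\times\Theta$ at $(\bar x,\bar y)$, then $$\operatorname{lip}_\Omega^\Theta S(\bar x,\bar y)=|D_M^*S_\Omega^\Theta(\bar x|\bar y)|^+=|D_N^*S_\Omega^\Theta(\bar x|\bar y)|^+.$$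
   Context: Conventions. "Reflexive Banach space" means a reflexive Banach space normed in such a way that both $X$ and $X^*$ are locally uniformly convex. $B_X$ is the closed unit ball; $\rightharpoonup^*$ is weak$^*$ convergence; $X\times Y$ carries the norm $\sqrt{\|x\|^2+\|y\|^2}$. $\mathcal N(\bar x)$ is the collection of open neighborhoods of $\bar x$. A set is closed around one of its points $\bar u$ if its intersection with some closed set containing $\bar u$ in its interior is closed. $\operatorname{gph}S=\{(x,y): y\in S(x)\}$; $S|_\Omega^\Theta(x)=S(x)\cap\Theta$ if $x\in\Omega$ and $\emptyset$ otherwise, so $\operatorname{gph}S|_\Omega^\Theta=\operatorname{gph}S\cap(\Omega\times\Theta)$; $S|^\Theta(x)=S(x)\cap\Theta$. Duality mapping: $J_X(x)=\{x^*\in X^*: \langle x^*,x\rangle=\|x\|^2,\ \|x^*\|=\|x\|\}$; for a set $A$, $J_X(A)=\bigcup_{x\in A}J_X(x)$. Contingent cone at $\bar x\in\Omega$: $T(\bar x;\Omega)=\{z: \exists\, t_k\downarrow0,\ z_k\to z,\ \bar x+t_kz_k\in\Omega\}$. $\varepsilon$-normals at $\bar x\in\Omega$ ($\varepsilon\ge0$): $\widehat N_\varepsilon(\bar x;\Omega)=\{x^*\in X^*: \limsup_{x\to\bar x,\,x\in\Omega}\langle x^*,x-\bar x\rangle/\|x-\bar x\|\le\varepsilon\}$. Relative contingent coderivatives. For $(\bar x,\bar y)\in\operatorname{gph}S|_\Omega^\Theta$, the normal contingent coderivative $D_N^*S_\Omega^\Theta(\bar x|\bar y):Y^*\rightrightarrows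 X^*$ assigns to $\bar y^*$ the set of all $\bar x^*$ for which there are $\varepsilon_k\downarrow0$, $(x_k,y_k)\to(\bar x,\bar y)$ with $(x_k,y_k)\in\operatorname{gph}S|_\Omega^\Theta$, and $x_k^*\rightharpoonup^*\bar x^*$, $y_k^*\rightharpoonup^*\bar y^*$ such that for all $k$ $$(x_k^*,-y_k^* )\in\widehat N_{\varepsilon_k}\big((x_k,y_k);\operatorname{gph}S|_\Omega^\Theta\big)\cap\big[J_X(T(x_k;\Omega))\times J_Y(T(y_k;\Theta))\big].\qquad( * )$$ The mixed contingent coderivative $D_M^*S_\Omega^\Theta(\bar x|\bar y)$ is defined in the same way with $y_k^*\rightharpoonup^*\bar y^*$ replaced by norm convergence $y_k^*\to\bar y^*$ (still $x_k^*\rightharpoonup^*\bar x^*$). Outer norm: $|H|^+=\sup_{y^*\in B_{Y^*}}\sup_{x^*\in H(y^* )}\|x^*\|$. $S$ is coderivatively normal relative to $\Omega\times\Theta$ at $(\bar x,\bar y)$ if $|D_M^*S_\Omega^\Theta(\bar x|\bar y)|^+=|D_N^*S_\Omega^\Theta(\bar x|\bar y)|^+$. PSNC: $S$ is PSNC relative to $\Omega\times\Theta$ at $(\bar x,\bar y)$ if for all sequences $\varepsilon_k\in(0,1)$, $(x_k,y_k)\in\operatorname{gph}S|_\Omega^\Theta$, $(x_k^*,y_k^* )$ satisfying $( * )$ with $\varepsilon_k\downarrow0$, $(x_k,y_k)\to(\bar x,\bar y)$, $x_k^*\rightharpoonup^*0$, $y_k^*\to0$, one has $\|x_k^*\|\to0$.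 Relative Lipschitz-like property: $S$ is Lipschitz-like relative to $\Omega\times\Theta$ around $(\bar x,\bar y)$ if $\operatorname{gph}S|_\Omega^\Theta$ is closed around this point and there are $V\in\mathcal N(\bar x)$, $W\in\mathcal N(\bar y)$, $\kappa\ge0$ with $S|^\Theta(x')\cap W\subset S|^\Theta(x)+\kappa\|x'-x\|B_Y$ for all $x,x'\in\Omega\cap V$. The infimum of all such $\kappa$ (over all $V,W$) is the exact Lipschitzian bound (modulus) $\operatorname{lip}_\Omega^\Theta S(\bar x,\bar y)$. *)

theory Defs
  imports "HOL-Analysis.Analysis"
begin

section \<open>Reflexive Banach spaces\<close>

definition locally_uniformly_convex :: "'a::real_normed_vector itself \<Rightarrow> bool" where
  "locally_uniformly_convex _ \<longleftrightarrow>
     (\<forall>(x::'a) (u::nat \<Rightarrow> 'a).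
        norm x = 1 \<longrightarrow> (\<forall>n. norm (u n) = 1) \<longrightarrow> (\<lambda>n. norm (x + u n)) \<longlonglongrightarrow> 2
        \<longrightarrow> u \<longlonglongrightarrow> x)"

text \<open>Reflexivity: the canonical embedding into the bidual is onto. The topological dual of
  \<open>'a\<close> is \<open>'a \<Rightarrow>\<^sub>L real\<close>, which carries the operator norm.\<close>

definition reflexive :: "'a::real_normed_vector itself \<Rightarrow> bool" where
  "reflexive _ \<longleftrightarrow>
     (\<forall>\<phi> :: ('a \<Rightarrow>\<^sub>L real) \<Rightarrow>\<^sub>L real. \<exists>x::'a. \<forall>f. blinfun_apply \<phi> f = blinfun_apply f x)"

definition reflexive_banach_luc :: "'a::banach itself \<Rightarrow> bool" where
  "reflexive_banach_luc _ \<longleftrightarrow>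
     reflexive TYPE('a) \<and> locally_uniformly_convex TYPE('a)
     \<and> locally_uniformly_convex TYPE('a \<Rightarrow>\<^sub>L real)"

definition finite_dimensional :: "'a::real_vector itself \<Rightarrow> bool" where
  "finite_dimensional _ \<longleftrightarrow> (\<exists>B::'a set. finite B \<and> span B = UNIV)"


section \<open>Convergence\<close>

definition weak_star_tendsto ::
    "(nat \<Rightarrow> ('a::real_normed_vector \<Rightarrow>\<^sub>L real)) \<Rightarrow> ('a \<Rightarrow>\<^sub>L real) \<Rightarrow> bool" where
  "weak_star_tendsto f l \<longleftrightarrow> (\<forall>x. (\<lambda>k. blinfun_apply (f k) x) \<longlonglongrightarrow> blinfun_apply l x)"

text \<open>\<open>t\<^sub>k \<down> 0\<close> means positive numbers tending to zero; monotonicity is not required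
  (passing to a subsequence would provide it).\<close>

definition decreases_to_0 :: "(nat \<Rightarrow> real) \<Rightarrow> bool" where
  "decreases_to_0 t \<longleftrightarrow> (\<forall>k. t k > 0) \<and> t \<longlonglongrightarrow> 0"


section \<open>Set-valued mappings\<close>

definition gph :: "('a \<Rightarrow> 'b set) \<Rightarrow> ('a \<times> 'b) set" where
  "gph S = {(x, y). y \<in> S x}"

definition restr :: "('a \<Rightarrow> 'b set) \<Rightarrow> 'a set \<Rightarrow> 'b set \<Rightarrow> 'a \<Rightarrow> 'b set" where
  "restr S \<Omega> \<Theta> x = (if x \<in> \<Omega> then S x \<inter> \<Theta> else {})"

lemma gph_restr: "gph (restr S \<Omega> \<Theta>) = gph S \<inter> (\<Omega> \<times> \<Theta>)"
  by (auto simp: gph_def restr_def split: if_splits)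

definition closed_around :: "'a::topological_space set \<Rightarrow> 'a \<Rightarrow> bool" where
  "closed_around A u \<longleftrightarrow> (\<exists>C. closed C \<and> u \<in> interior C \<and> closed (A \<inter> C))"


section \<open>Duality mapping, tangents and normals\<close>

definition duality_map :: "'a::real_normed_vector \<Rightarrow> ('a \<Rightarrow>\<^sub>L real) set" where
  "duality_map x = {f. blinfun_apply f x = (norm x)\<^sup>2 \<and> norm f = norm x}"

definition contingent_cone :: "'a::real_normed_vector \<Rightarrow> 'a set \<Rightarrow> 'a set" where
  "contingent_cone x \<Omega> =
     {z. \<exists>t u. decreases_to_0 t \<and> u \<longlonglongrightarrow> z \<and> (\<forall>k. x + t k *\<^sub>R u k \<in> \<Omega>)}"

text \<open>The punctured filter \<open>at x within \<Omega>\<close> excludes the point itself; at an isolated point of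
  \<open>\<Omega>\<close> it is trivial and the upper limit is \<open>-\<infinity>\<close>, so that every functional is normal.\<close>

definition eps_normals ::
    "real \<Rightarrow> 'a::real_normed_vector \<Rightarrow> 'a set \<Rightarrow> ('a \<Rightarrow>\<^sub>L real) set" where
  "eps_normals \<epsilon> x \<Omega> =
     {f. Limsup (at x within \<Omega>) (\<lambda>u. ereal (blinfun_apply f (u - x) / norm (u - x))) \<le> ereal \<epsilon>}"

text \<open>The functional \<open>(x, y) \<mapsto> \<langle>x\<^sup>*, x\<rangle> + \<langle>y\<^sup>*, y\<rangle>\<close> on the product. The product
  type carries the norm \<open>sqrt ((norm x)\<^sup>2 + (norm y)\<^sup>2)\<close>.\<close>

definition dual_pair ::
    "('a::real_normed_vector \<Rightarrow>\<^sub>L real) \<Rightarrow> ('b::real_normed_vector \<Rightarrow>\<^sub>L real)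
       \<Rightarrow> ('a \<times> 'b) \<Rightarrow>\<^sub>L real" where
  "dual_pair f g = (f o\<^sub>L fst_blinfun) + (g o\<^sub>L snd_blinfun)"

lemma dual_pair_apply:
  "blinfun_apply (dual_pair f g) (x, y) = blinfun_apply f x + blinfun_apply g y"
  by (simp add: dual_pair_def blinfun.add_left)


section \<open>Relative contingent coderivatives\<close>

text \<open>The relation
  \<open>(x\<^sup>*, z\<^sup>*) \<in> N\<^sub>\<epsilon>((x, y); gph S|) \<inter> (J(T(x; \<Omega>)) \<times> J(T(y; \<Theta>)))\<close> for a point \<open>(x, y)\<close> of
  the restricted graph. In the coderivatives it is used with \<open>z\<^sup>* = -y\<^sup>*\<close>, so the
  sign change also enters the membership in \<open>J(T(y; \<Theta>))\<close>.\<close>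

definition contingent_normal_pair ::
    "('a::real_normed_vector \<Rightarrow> 'b::real_normed_vector set) \<Rightarrow> 'a set \<Rightarrow> 'b set \<Rightarrow> real
       \<Rightarrow> 'a \<Rightarrow> 'b \<Rightarrow> ('a \<Rightarrow>\<^sub>L real) \<Rightarrow> ('b \<Rightarrow>\<^sub>L real) \<Rightarrow> bool" where
  "contingent_normal_pair S \<Omega> \<Theta> \<epsilon> x y xs zs \<longleftrightarrow>
     (x, y) \<in> gph (restr S \<Omega> \<Theta>)
     \<and> dual_pair xs zs \<in> eps_normals \<epsilon> (x, y) (gph (restr S \<Omega> \<Theta>))
     \<and> xs \<in> (\<Union>v\<in>contingent_cone x \<Omega>. duality_map v)
     \<and> zs \<in> (\<Union>w\<in>contingent_cone y \<Theta>. duality_map w)"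

definition normal_coderivative ::
    "('a::real_normed_vector \<Rightarrow> 'b::real_normed_vector set) \<Rightarrow> 'a set \<Rightarrow> 'b set \<Rightarrow> 'a \<Rightarrow> 'b
       \<Rightarrow> ('b \<Rightarrow>\<^sub>L real) \<Rightarrow> ('a \<Rightarrow>\<^sub>L real) set" where
  "normal_coderivative S \<Omega> \<Theta> xb yb ysb =
     {xsb. \<exists>\<epsilon> x y xs ys.
        decreases_to_0 \<epsilon> \<and> (\<lambda>k. (x k, y k)) \<longlonglongrightarrow> (xb, yb)
        \<and> weak_star_tendsto xs xsb \<and> weak_star_tendsto ys ysb
        \<and> (\<forall>k. contingent_normal_pair S \<Omega> \<Theta> (\<epsilon> k) (x k) (y k) (xs k) (- ys k))}"

definition mixed_coderivative ::
    "('a::real_normed_vector \<Rightarrow> 'b::real_normed_vector set) \<Rightarrow> 'a set \<Rightarrow> 'b set \<Rightarrow> 'a \<Rightarrow> 'b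
       \<Rightarrow> ('b \<Rightarrow>\<^sub>L real) \<Rightarrow> ('a \<Rightarrow>\<^sub>L real) set" where
  "mixed_coderivative S \<Omega> \<Theta> xb yb ysb =
     {xsb. \<exists>\<epsilon> x y xs ys.
        decreases_to_0 \<epsilon> \<and> (\<lambda>k. (x k, y k)) \<longlonglongrightarrow> (xb, yb)
        \<and> weak_star_tendsto xs xsb \<and> ys \<longlonglongrightarrow> ysb
        \<and> (\<forall>k. contingent_normal_pair S \<Omega> \<Theta> (\<epsilon> k) (x k) (y k) (xs k) (- ys k))}"

text \<open>Suprema of norms are taken in \<open>[0, \<infinity>]\<close>, where the empty supremum is \<open>0\<close>.\<close>

definition outer_norm ::
    "('b::real_normed_vector \<Rightarrow> 'a::real_normed_vector set) \<Rightarrow> ennreal" where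
  "outer_norm H = (SUP ys\<in>cball 0 1. SUP xs\<in>H ys. ennreal (norm xs))"

definition coderivatively_normal ::
    "('a::real_normed_vector \<Rightarrow> 'b::real_normed_vector set) \<Rightarrow> 'a set \<Rightarrow> 'b set
       \<Rightarrow> 'a \<Rightarrow> 'b \<Rightarrow> bool" where
  "coderivatively_normal S \<Omega> \<Theta> xb yb \<longleftrightarrow>
     outer_norm (mixed_coderivative S \<Omega> \<Theta> xb yb) = outer_norm (normal_coderivative S \<Omega> \<Theta> xb yb)"

definition psnc ::
    "('a::real_normed_vector \<Rightarrow> 'b::real_normed_vector set) \<Rightarrow> 'a set \<Rightarrow> 'b set
       \<Rightarrow> 'a \<Rightarrow> 'b \<Rightarrow> bool" where
  "psnc S \<Omega> \<Theta> xb yb \<longleftrightarrow>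
     (\<forall>\<epsilon> x y xs ys.
        (\<forall>k. 0 < \<epsilon> k \<and> \<epsilon> k < 1) \<longrightarrow> decreases_to_0 \<epsilon>
        \<longrightarrow> (\<lambda>k. (x k, y k)) \<longlonglongrightarrow> (xb, yb)
        \<longrightarrow> weak_star_tendsto xs 0 \<longrightarrow> ys \<longlonglongrightarrow> 0
        \<longrightarrow> (\<forall>k. contingent_normal_pair S \<Omega> \<Theta> (\<epsilon> k) (x k) (y k) (xs k) (- ys k))
        \<longrightarrow> (\<lambda>k. norm (xs k)) \<longlonglongrightarrow> 0)"


section \<open>The relative Lipschitz-like property\<close>

text \<open>The sum on the right-hand side is the Minkowski sum of sets.\<close>

definition lipschitz_like_const ::
    "('a::real_normed_vector \<Rightarrow> 'b::real_normed_vector set) \<Rightarrow> 'a set \<Rightarrow> 'b set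
       \<Rightarrow> 'a \<Rightarrow> 'b \<Rightarrow> real \<Rightarrow> bool" where
  "lipschitz_like_const S \<Omega> \<Theta> xb yb \<kappa> \<longleftrightarrow>
     0 \<le> \<kappa> \<and>
     (\<exists>V W. open V \<and> xb \<in> V \<and> open W \<and> yb \<in> W \<and>
        (\<forall>x\<in>\<Omega> \<inter> V. \<forall>x'\<in>\<Omega> \<inter> V.
           (S x' \<inter> \<Theta>) \<inter> W
             \<subseteq> (S x \<inter> \<Theta>) + (\<lambda>b. (\<kappa> * norm (x' - x)) *\<^sub>R b) ` cball 0 1))"

definition lipschitz_like ::
    "('a::real_normed_vector \<Rightarrow> 'b::real_normed_vector set) \<Rightarrow> 'a set \<Rightarrow> 'b set
       \<Rightarrow> 'a \<Rightarrow> 'b \<Rightarrow> bool" where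
  "lipschitz_like S \<Omega> \<Theta> xb yb \<longleftrightarrow>
     closed_around (gph (restr S \<Omega> \<Theta>)) (xb, yb) \<and> (\<exists>\<kappa>. lipschitz_like_const S \<Omega> \<Theta> xb yb \<kappa>)"

definition lip_modulus ::
    "('a::real_normed_vector \<Rightarrow> 'b::real_normed_vector set) \<Rightarrow> 'a set \<Rightarrow> 'b set
       \<Rightarrow> 'a \<Rightarrow> 'b \<Rightarrow> ennreal" where
  "lip_modulus S \<Omega> \<Theta> xb yb = (INF \<kappa>\<in>{\<kappa>. lipschitz_like_const S \<Omega> \<Theta> xb yb \<kappa>}. ennreal \<kappa>)"

end

theory Submission
  imports Defs "HOL-Complex_Analysis.Great_Picard"
begin

text \<open>Two facts link the Lipschitz-like property with contingent normals.

  If the property holds with constant \<open>\<kappa>\<close>, every pair \<open>(x\<^sup>*, - y\<^sup>*)\<close> of \<open>\<epsilon>\<close>-normals of the kind used in the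
  coderivatives satisfies \<open>norm x\<^sup>* \<le> \<kappa> * norm y\<^sup>* + \<epsilon> * (1 + \<kappa>)\<close> near the reference point
  (\<open>lipschitz_like_normal_bound\<close>): \<open>x\<^sup>*\<close> is the image under the duality mapping of a direction tangent to
  \<open>\<Omega>\<close>, and the graph can be followed along that direction. In the limit this gives the PSNC property,
  \<open>norm x\<^sup>* \<le> \<kappa> * norm y\<^sup>*\<close> for the mixed coderivative, and the lower estimate of the modulus.

  If the property fails with constant \<open>\<kappa>'\<close>, then for every \<open>\<kappa> < \<kappa>'\<close> there are such normals arbitrarily
  close to the reference point with \<open>norm x\<^sup>* = 1\<close> and \<open>norm y\<^sup>* \<le> 1 / \<kappa>\<close>
  (\<open>not_lipschitz_like_normal_pair\<close>). They are minus the derivative of a smoothed distance function at an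
  almost minimiser on the graph, furnished by Ekeland's principle; differentiability comes from the local
  uniform convexity of the dual spaces. Constants \<open>\<kappa>'\<close> tending to infinity, together with weak-star
  sequential compactness of dual balls, show that the PSNC property and a trivial mixed coderivative at
  \<open>0\<close> imply the Lipschitz-like property. A fixed \<open>\<kappa>'\<close> just below the modulus gives the upper estimate
  when the domain space has finite dimension, where weak-star convergence of the \<open>x\<^sup>*\<close> preserves their
  norm.

  Finiteness of the outer norm forces the mixed coderivative at \<open>0\<close> to be trivial by positive
  homogeneity. The functional-analytic tools, namely norming and annihilating functionals and weak-star
  sequential compactness in reflexive spaces, all come from the fact that a minimal sublinear functional
  is linear.\<close>

section \<open>Sublinear functionals and linear support functionals\<close>

text \<open>Finite subadditive and positively homogeneous functionals. Only the inequality
  \<open>p (c x) \<le> c p x\<close> for \<open>c > 0\<close> is required: applied to \<open>1 / c\<close> it gives the reverse inequality,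
  and \<open>p 0 = 0\<close> follows.\<close>

definition sublinear :: "('a::real_vector \<Rightarrow> real) \<Rightarrow> bool" where
  "sublinear p \<longleftrightarrow> (\<forall>x y. p (x + y) \<le> p x + p y) \<and> (\<forall>c x. c > 0 \<longrightarrow> p (c *\<^sub>R x) \<le> c * p x)"

lemma sublinear_add: "sublinear p \<Longrightarrow> p (x + y) \<le> p x + p y"
  by (simp add: sublinear_def)

lemma sublinear_scale_le: "sublinear p \<Longrightarrow> c > 0 \<Longrightarrow> p (c *\<^sub>R x) \<le> c * p x"
  by (simp add: sublinear_def)

lemma sublinear_scale:
  assumes "sublinear p" "c > 0"
  shows "p (c *\<^sub>R x) = c * p x"
proof (rule antisym)
  have "p ((1/c) *\<^sub>R (c *\<^sub>R x)) \<le> (1/c) * p (c *\<^sub>R x)"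
    using assms by (intro sublinear_scale_le) auto
  then show "c * p x \<le> p (c *\<^sub>R x)"
    using assms(2) by (simp add: field_simps)
qed (use assms sublinear_scale_le in blast)

lemma sublinear_zero: "sublinear p \<Longrightarrow> p 0 = 0"
  using sublinear_scale[of p 2 0] by simp

lemma sublinear_scale_nonneg: "sublinear p \<Longrightarrow> c \<ge> 0 \<Longrightarrow> p (c *\<^sub>R x) = c * p x"
  using sublinear_scale[of p c x] sublinear_zero[of p] by (cases "c = 0") auto

lemma sublinear_uminus: "sublinear p \<Longrightarrow> - p (- x) \<le> p x"
  using sublinear_add[of p x "- x"] sublinear_zero[of p] by simp

text \<open>For sublinear \<open>p\<close> the functional \<open>tilt p y\<close> is sublinear again, lies below \<open>p\<close>, and its value at \<open>- y\<close> is at most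
  \<open>- p y\<close>. Hence every linear functional below \<open>tilt p y\<close> lies below \<open>p\<close> and agrees with \<open>p\<close> at \<open>y\<close>.\<close>

definition tilt :: "('a::real_vector \<Rightarrow> real) \<Rightarrow> 'a \<Rightarrow> 'a \<Rightarrow> real" where
  "tilt p y x = (INF t\<in>{0..}. p (x + t *\<^sub>R y) - t * p y)"

lemma tilt_bounded_below:
  assumes "sublinear p"
  shows "bdd_below ((\<lambda>t. p (x + t *\<^sub>R y) - t * p y) ` {0..})"
proof (rule bdd_belowI2)
  fix t :: real assume "t \<in> {0..}"
  then show "- p (- x) \<le> p (x + t *\<^sub>R y) - t * p y"
    using sublinear_add[OF assms, of "x + t *\<^sub>R y" "- x"] sublinear_scale_nonneg[OF assms, of t y]
    by simp
qed

lemma tilt_le: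
  assumes "sublinear p" "t \<ge> 0"
  shows "tilt p y x \<le> p (x + t *\<^sub>R y) - t * p y"
  unfolding tilt_def by (rule cINF_lower) (use assms tilt_bounded_below in auto)

lemma sublinear_tilt:
  fixes p :: "'a::real_vector \<Rightarrow> real"
  assumes p: "sublinear p"
  shows "sublinear (tilt p y)"
  unfolding sublinear_def
proof (intro conjI allI impI)
  fix x x' :: 'a
  have *: "tilt p y (x + x') \<le> (p (x + t *\<^sub>R y) - t * p y) + (p (x' + s *\<^sub>R y) - s * p y)"
    if "t \<ge> 0" "s \<ge> 0" for s t
    using tilt_le[OF p, of "t + s" y "x + x'"] that
      sublinear_add[OF p, of "x + t *\<^sub>R y" "x' + s *\<^sub>R y"]
    by (simp add: algebra_simps)
  have "tilt p y (x + x') - (p (x + t *\<^sub>R y) - t * p y) \<le> tilt p y x'" if "t \<ge> 0" for t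
    unfolding tilt_def[of p y x'] by (rule cINF_greatest) (use *[OF that] in \<open>auto simp: diff_le_eq algebra_simps\<close>)
  then have "tilt p y (x + x') - tilt p y x' \<le> tilt p y x"
    unfolding tilt_def[of p y x] by (intro cINF_greatest) (auto simp: algebra_simps)
  then show "tilt p y (x + x') \<le> tilt p y x + tilt p y x'" by simp
next
  fix c :: real and x :: 'a
  assume c: "c > 0"
  have "tilt p y (c *\<^sub>R x) / c \<le> tilt p y x"
    unfolding tilt_def[of p y x]
  proof (rule cINF_greatest)
    fix t :: real assume t: "t \<in> {0..}"
    have "tilt p y (c *\<^sub>R x) \<le> p (c *\<^sub>R (x + t *\<^sub>R y)) - c * t * p y"
      using tilt_le[OF p, of "c * t" y "c *\<^sub>R x"] c t by (simp add: algebra_simps)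
    also have "\<dots> = c * (p (x + t *\<^sub>R y) - t * p y)"
      using sublinear_scale[OF p c, of "x + t *\<^sub>R y"] by (simp only: right_diff_distrib mult.assoc)
    finally show "tilt p y (c *\<^sub>R x) / c \<le> p (x + t *\<^sub>R y) - t * p y"
      using c by (simp add: field_simps)
  qed auto
  then show "tilt p y (c *\<^sub>R x) \<le> c * tilt p y x"
    using c by (simp add: field_simps)
qed

text \<open>The chain condition makes the infimum subadditive: given \<open>q\<close> and \<open>q'\<close> in the chain, the smaller
  of the two satisfies \<open>r (x + y) \<le> r x + r y \<le> q x + q' y\<close>.\<close>

lemma sublinear_INF_chain:
  fixes C :: "('a::real_vector \<Rightarrow> real) set"
  assumes ne: "C \<noteq> {}" and sub: "\<And>q. q \<in> C \<Longrightarrow> sublinear q" and below: "\<And>q. q \<in> C \<Longrightarrow> q \<le> p"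
    and chain: "\<And>q q'. q \<in> C \<Longrightarrow> q' \<in> C \<Longrightarrow> q \<le> q' \<or> q' \<le> q"
  shows "sublinear (\<lambda>x. INF q\<in>C. q x)" and "\<And>q. q \<in> C \<Longrightarrow> (\<lambda>x. INF q\<in>C. q x) \<le> q"
proof -
  have bdd: "bdd_below ((\<lambda>q. q x) ` C)" for x
  proof (rule bdd_belowI2)
    fix q assume "q \<in> C"
    then show "- p (- x) \<le> q x"
      using sublinear_uminus[OF sub, of q x] below[of q] by (auto simp: le_fun_def intro: order_trans[rotated])
  qed
  show low: "(\<lambda>x. INF q\<in>C. q x) \<le> q" if "q \<in> C" for q
    using that bdd by (auto simp: le_fun_def intro: cINF_lower)
  let ?u = "\<lambda>x. INF q\<in>C. q x"
  show "sublinear ?u"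
    unfolding sublinear_def
  proof (intro conjI allI impI)
    fix x y :: 'a
    have *: "?u (x + y) \<le> q x + q' y" if "q \<in> C" "q' \<in> C" for q q'
    proof -
      have "\<exists>r\<in>C. r \<le> q \<and> r \<le> q'" using chain[of q q'] that by blast
      then obtain r where r: "r \<in> C" "r \<le> q" "r \<le> q'" by blast
      have "?u (x + y) \<le> r (x + y)" using low[OF r(1)] by (simp add: le_fun_def)
      also have "\<dots> \<le> r x + r y" using sublinear_add[OF sub[OF r(1)]] .
      also have "\<dots> \<le> q x + q' y" using r by (auto simp: le_fun_def intro: add_mono)
      finally show ?thesis .
    qed
    have "?u (x + y) - q x \<le> ?u y" if "q \<in> C" for q
      by (rule cINF_greatest[OF ne]) (use *[OF that] in \<open>auto simp: diff_le_eq algebra_simps\<close>)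
    then have "?u (x + y) - ?u y \<le> ?u x"
      by (intro cINF_greatest[OF ne]) (auto simp: algebra_simps)
    then show "?u (x + y) \<le> ?u x + ?u y" by simp
  next
    fix c :: real and x :: 'a
    assume c: "c > 0"
    have "?u (c *\<^sub>R x) / c \<le> ?u x"
    proof (rule cINF_greatest[OF ne])
      fix q assume q: "q \<in> C"
      have "?u (c *\<^sub>R x) \<le> q (c *\<^sub>R x)" using low[OF q] by (simp add: le_fun_def)
      also have "\<dots> = c * q x" using sublinear_scale[OF sub[OF q] c] .
      finally show "?u (c *\<^sub>R x) / c \<le> q x" using c by (simp add: field_simps)
    qed
    then show "?u (c *\<^sub>R x) \<le> c * ?u x" using c by (simp add: field_simps)
  qed
qed

text \<open>Minimality forces \<open>tilt m y = m\<close>, and the parameter value \<open>t = 1\<close> in the definition of \<open>tilt\<close> then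
  gives superadditivity.\<close>

lemma minimal_sublinear_linear:
  fixes m :: "'a::real_vector \<Rightarrow> real"
  assumes m: "sublinear m" and minimal: "\<And>q. sublinear q \<Longrightarrow> q \<le> m \<Longrightarrow> q = m"
  shows "linear m"
proof -
  have le: "tilt m y \<le> m" for y
    using tilt_le[OF m, of 0 y] by (simp add: le_fun_def)
  have "m x + m y \<le> m (x + y)" for x y
    using minimal[OF sublinear_tilt[OF m] le, of y] tilt_le[OF m, of 1 y x] by simp
  then have add: "m (x + y) = m x + m y" for x y
    using sublinear_add[OF m] by (simp add: antisym)
  have neg: "m (- x) = - m x" for x
    using add[of x "- x"] sublinear_zero[OF m] by simp
  have "m (c *\<^sub>R x) = c * m x" for c x
    using sublinear_scale_nonneg[OF m, of c x] sublinear_scale_nonneg[OF m, of "- c" x] neg[of "c *\<^sub>R x"]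
    by (cases "c \<ge> 0") auto
  then show ?thesis by (intro linearI) (auto simp: add)
qed

lemma exists_linear_below:
  fixes p :: "'a::real_vector \<Rightarrow> real"
  assumes p: "sublinear p"
  shows "\<exists>l. linear l \<and> l \<le> p"
proof -
  define A where "A = {q. sublinear q \<and> q \<le> p}"
  let ?P = "\<lambda>q q'. q' \<le> (q::'a \<Rightarrow> real)"
  have "\<exists>m\<in>A. \<forall>a\<in>A. ?P m a \<longrightarrow> a = m"
  proof (rule predicate_Zorn)
    show "partial_order_on A (relation_of ?P A)"
      by (rule partial_order_on_relation_ofI) auto
  next
    fix C assume C: "C \<in> Chains (relation_of ?P A)"
    then have chain: "q \<le> q' \<or> q' \<le> q" if "q \<in> C" "q' \<in> C" for q q'
      using that by (auto simp: Chains_def relation_of_def)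
    show "\<exists>u\<in>A. \<forall>a\<in>C. ?P a u"
    proof (cases "C = {}")
      case True
      then show ?thesis using p by (auto simp: A_def)
    next
      case False
      then obtain q0 where q0: "q0 \<in> C" by blast
      have sub: "sublinear q" and below: "q \<le> p" if "q \<in> C" for q
        using C that by (auto simp: A_def Chains_def relation_of_def)
      have inf: "sublinear (\<lambda>x. INF q\<in>C. q x)" "\<And>q. q \<in> C \<Longrightarrow> (\<lambda>x. INF q\<in>C. q x) \<le> q"
        using sublinear_INF_chain[of C p] False sub below chain by blast+
      have "(\<lambda>x. INF q\<in>C. q x) \<in> A"
        using inf(1) order_trans[OF inf(2)[OF q0] below[OF q0]] by (simp add: A_def)
      then show ?thesis using inf(2) by blast
    qed
  qed
  then obtain m where m: "sublinear m" "m \<le> p" and min: "\<And>q. q \<in> A \<Longrightarrow> q \<le> m \<Longrightarrow> q = m"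
    by (auto simp: A_def)
  have "linear m"
    using m(1) by (rule minimal_sublinear_linear) (use m min in \<open>auto simp: A_def\<close>)
  then show ?thesis using m(2) by blast
qed

text \<open>The Hahn--Banach theorem in its support form. With \<open>p\<close> the norm it yields norming functionals; with
  \<open>p\<close> the distance from a subspace it yields functionals annihilating that subspace.\<close>

lemma hahn_banach_support:
  fixes p :: "'a::real_vector \<Rightarrow> real"
  assumes p: "sublinear p"
  shows "\<exists>l. linear l \<and> (\<forall>x. l x \<le> p x) \<and> l a = p a"
proof -
  obtain l where l: "linear l" "l \<le> tilt p a"
    using exists_linear_below[OF sublinear_tilt[OF p]] by blast
  have le: "l x \<le> p x" for x
    using l(2) tilt_le[OF p, of 0 a x] by (auto simp: le_fun_def intro: order_trans)
  have "l (- a) \<le> - p a"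
    using l(2) tilt_le[OF p, of 1 a "- a"] sublinear_zero[OF p]
    by (auto simp: le_fun_def intro: order_trans)
  then have "p a \<le> l a" using linear_neg[OF l(1), of a] by simp
  with le l(1) show ?thesis by (auto intro: antisym)
qed

lemma linear_le_norm_blinfun:
  fixes l :: "'a::real_normed_vector \<Rightarrow> real"
  assumes l: "linear l" and le: "\<And>x. l x \<le> C * norm x"
  shows "\<exists>f. blinfun_apply f = l"
proof -
  have "\<bar>l x\<bar> \<le> norm x * C" for x
    using le[of x] le[of "- x"] linear_neg[OF l, of x] by (auto simp: abs_le_iff mult.commute)
  then have "bounded_linear l"
    using l by (intro bounded_linear_intro[where K = C]) (auto simp: linear_add linear_scale)
  then show ?thesis using bounded_linear_Blinfun_apply by blast
qed

lemma norming_functional: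
  fixes a :: "'a::real_normed_vector"
  assumes "a \<noteq> 0"
  shows "\<exists>f::'a \<Rightarrow>\<^sub>L real. norm f = 1 \<and> blinfun_apply f a = norm a"
proof -
  have "sublinear (norm :: 'a \<Rightarrow> real)" by (auto simp: sublinear_def norm_triangle_ineq)
  then obtain l :: "'a \<Rightarrow> real" where l: "linear l" "\<And>x. l x \<le> norm x" "l a = norm a"
    using hahn_banach_support by blast
  obtain f where f: "blinfun_apply f = l" using linear_le_norm_blinfun[OF l(1), of 1] l(2) by auto
  have "\<bar>l x\<bar> \<le> norm x" for x
    using l(2)[of x] l(2)[of "- x"] linear_neg[OF l(1), of x] by (auto simp: abs_le_iff)
  then have "norm f \<le> 1" by (intro norm_blinfun_bound) (auto simp: f)
  moreover have "norm a \<le> norm f * norm a"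
    using norm_blinfun[of f a] by (simp add: f l)
  then have "norm f \<ge> 1" using assms by simp
  ultimately show ?thesis using f l by (intro exI[of _ f]) auto
qed

lemma sublinear_infdist:
  fixes M :: "'a::real_normed_vector set"
  assumes M: "subspace M"
  shows "sublinear (\<lambda>x. infdist x M)"
proof -
  have ne: "M \<noteq> {}" using subspace_0[OF M] by auto
  have ex: "\<exists>m\<in>M. dist x m < infdist x M + e" if "e > 0" for x e
    using that cInf_lessD[of "dist x ` M" "infdist x M + e"] ne by (auto simp: infdist_notempty)
  show ?thesis
    unfolding sublinear_def
  proof (intro conjI allI impI)
    fix x y :: 'a
    show "infdist (x + y) M \<le> infdist x M + infdist y M"
    proof (rule field_le_epsilon)
      fix e :: real assume "e > 0"
      then obtain m n where mn: "m \<in> M" "dist x m < infdist x M + e/2" "n \<in> M" "dist y n < infdist y M + e/2"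
        using ex[of "e/2"] by (meson half_gt_zero)
      have "infdist (x + y) M \<le> dist (x + y) (m + n)"
        using M mn by (intro infdist_le subspace_add)
      also have "\<dots> \<le> dist x m + dist y n" by (rule dist_triangle_add)
      finally show "infdist (x + y) M \<le> infdist x M + infdist y M + e" using mn by simp
    qed
  next
    fix c :: real and x :: 'a
    assume c: "c > 0"
    show "infdist (c *\<^sub>R x) M \<le> c * infdist x M"
    proof (rule field_le_epsilon)
      fix e :: real assume "e > 0"
      then obtain m where m: "m \<in> M" "dist x m < infdist x M + e/c"
        using ex[of "e/c"] c by (meson divide_pos_pos)
      have "infdist (c *\<^sub>R x) M \<le> dist (c *\<^sub>R x) (c *\<^sub>R m)"
        using M m by (intro infdist_le subspace_scale)
      also have "\<dots> = c * dist x m" using c by (simp add: dist_norm flip: scaleR_diff_right)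
      also have "\<dots> \<le> c * (infdist x M + e/c)" using m c by (intro mult_left_mono) auto
      finally show "infdist (c *\<^sub>R x) M \<le> c * infdist x M + e" using c by (simp add: algebra_simps)
    qed
  qed
qed

lemma annihilating_functional:
  fixes M :: "'a::real_normed_vector set"
  assumes M: "subspace M" and cl: "closed M" and a: "a \<notin> M"
  shows "\<exists>f::'a \<Rightarrow>\<^sub>L real. (\<forall>x\<in>M. blinfun_apply f x = 0) \<and> blinfun_apply f a \<noteq> 0"
proof -
  obtain l where l: "linear l" "\<And>x. l x \<le> infdist x M" "l a = infdist a M"
    using hahn_banach_support[OF sublinear_infdist[OF M]] by blast
  have "infdist x M \<le> 1 * norm x" for x
    using infdist_le[OF subspace_0[OF M], of x] by simp
  then obtain f where f: "blinfun_apply f = l"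
    using linear_le_norm_blinfun[OF l(1), of 1] l(2) order_trans by metis
  have "l x = 0" if "x \<in> M" for x
    using l(2)[of x] l(2)[of "- x"] linear_neg[OF l(1), of x] that subspace_neg[OF M that] by simp
  moreover have "infdist a M \<noteq> 0"
    using in_closed_iff_infdist_zero[OF cl, of a] subspace_0[OF M] a by auto
  ultimately show ?thesis using f l by (intro exI[of _ f]) auto
qed

section \<open>Weak-star convergent sequences of functionals\<close>

lemma countable_dense_in_span:
  fixes d :: "nat \<Rightarrow> 'a::real_normed_vector"
  shows "\<exists>A. countable A \<and> span (range d) \<subseteq> closure A"
proof -
  \<comment> \<open>The rational linear combinations of the vectors \<open>d n\<close>, indexed by lists.\<close>
  define A where "A = range (\<lambda>l :: (rat \<times> nat) list. sum_list (map (\<lambda>(q, n). of_rat q *\<^sub>R d n) l))"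
  have "0 \<in> A" unfolding A_def by (rule range_eqI[of _ _ "[]"]) simp
  have A_add: "of_rat q *\<^sub>R d n + a \<in> A" if a: "a \<in> A" for q n a
  proof -
    obtain l where "a = sum_list (map (\<lambda>(q, n). of_rat q *\<^sub>R d n) l)" using a unfolding A_def by blast
    then show ?thesis unfolding A_def by (intro range_eqI[of _ _ "(q, n) # l"]) simp
  qed
  have "x \<in> closure A" if "x \<in> span (range d)" for x
    using that
  proof (induction rule: span_induct_alt)
    case base
    then show ?case using \<open>0 \<in> A\<close> closure_subset by blast
  next
    case (step c v y)
    then obtain n where v: "v = d n" by blast
    show ?case
      unfolding closure_approachable
    proof (intro allI impI)
      fix e :: real assume e: "e > 0"
      obtain a where a: "a \<in> A" "dist a y < e / 2"
        using step(2) e unfolding closure_approachable by (meson half_gt_zero)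
      define t where "t = e / (2 * (norm v + 1))"
      have nv: "norm v + 1 > 0" by (simp add: add_nonneg_pos)
      then have "t > 0" using e by (simp add: t_def)
      then obtain q where q: "c < of_rat q" "of_rat q < c + t" using of_rat_dense[of c "c + t"] by auto
      have "dist (of_rat q *\<^sub>R v + a) (c *\<^sub>R v + y) \<le> dist (of_rat q *\<^sub>R v) (c *\<^sub>R v) + dist a y"
        by (rule dist_triangle_add)
      also have "dist (of_rat q *\<^sub>R v) (c *\<^sub>R v) = \<bar>of_rat q - c\<bar> * norm v"
        by (simp add: dist_norm flip: scaleR_diff_left)
      also have "\<dots> \<le> t * norm v" using q by (intro mult_right_mono) auto
      also have "\<dots> \<le> t * (norm v + 1)" using \<open>t > 0\<close> by (intro mult_left_mono) auto
      also have "\<dots> = e / 2" using nv by (simp add: t_def divide_simps)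
      finally have "dist (of_rat q *\<^sub>R v + a) (c *\<^sub>R v + y) < e" using a by simp
      then show "\<exists>z\<in>A. dist z (c *\<^sub>R v + y) < e" using A_add[OF a(1), of q n] v by blast
    qed
  qed
  moreover have "countable A" unfolding A_def by (rule countable_image) auto
  ultimately show ?thesis by blast
qed

lemma subspace_closure:
  fixes S :: "'a::real_normed_vector set"
  assumes S: "subspace S"
  shows "subspace (closure S)"
proof (rule subspaceI)
  show "0 \<in> closure S" using subspace_0[OF S] closure_subset by blast
next
  fix x y assume "x \<in> closure S" "y \<in> closure S"
  then obtain u v where "\<forall>n. u n \<in> S" "u \<longlonglongrightarrow> x" "\<forall>n. v n \<in> S" "v \<longlonglongrightarrow> y"
    by (auto simp: closure_sequential)
  then show "x + y \<in> closure S"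
    unfolding closure_sequential
    by (intro exI[of _ "\<lambda>n. u n + v n"]) (auto intro: tendsto_add subspace_add[OF S])
next
  fix c x assume "x \<in> closure S"
  then obtain u where "\<forall>n. u n \<in> S" "u \<longlonglongrightarrow> x"
    by (auto simp: closure_sequential)
  then show "c *\<^sub>R x \<in> closure S"
    unfolding closure_sequential
    by (intro exI[of _ "\<lambda>n. c *\<^sub>R u n"]) (auto intro: tendsto_scaleR subspace_scale[OF S])
qed

lemma blinfun_almost_norming:
  fixes g :: "'a::real_normed_vector \<Rightarrow>\<^sub>L real"
  shows "\<exists>x. norm x \<le> 1 \<and> norm g \<le> 2 * blinfun_apply g x"
proof (rule ccontr)
  assume "\<not> ?thesis"
  then have H: "2 * blinfun_apply g x < norm g" if "norm x \<le> 1" for x using that by force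
  have g: "norm g > 0" using H[of 0] by simp
  have "norm g \<le> norm g / 2"
  proof (rule norm_blinfun_bound)
    fix x :: 'a
    show "norm (blinfun_apply g x) \<le> norm g / 2 * norm x"
    proof (cases "x = 0")
      case False
      have "2 * blinfun_apply g ((1 / norm x) *\<^sub>R x) < norm g" "2 * blinfun_apply g (- ((1 / norm x) *\<^sub>R x)) < norm g"
        using False by (auto intro!: H)
      then have "2 * blinfun_apply g x < norm g * norm x" "- (2 * blinfun_apply g x) < norm g * norm x"
        using False by (simp_all add: blinfun.scaleR_right blinfun.minus_right field_simps)
      then show ?thesis by (simp add: abs_le_iff)
    qed simp
  qed (use g in simp)
  with g show False by simp
qed

text \<open>Sequential weak-star compactness of balls in the dual of a reflexive space. A countable set \<open>A\<close> is
  dense in the span of the sequence, and a subsequence is chosen that converges at an almost norming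
  point of each element of \<open>A\<close>. The points where the subsequence converges form a closed subspace
  \<open>M\<close>. A functional \<open>g\<close> that annihilates \<open>M\<close> lies in the closed span of the sequence, since otherwise
  reflexivity would provide a point of \<open>M\<close> at which \<open>g\<close> does not vanish. So \<open>g\<close> is approximated by
  elements of \<open>A\<close>, which are almost normed at points of \<open>M\<close>; this forces \<open>g = 0\<close>.\<close>

lemma bounded_seq_weak_star_subseq:
  fixes f :: "nat \<Rightarrow> ('a::real_normed_vector \<Rightarrow>\<^sub>L real)"
  assumes refl: "reflexive TYPE('a)" and bnd: "\<And>n. norm (f n) \<le> C"
  shows "\<exists>r l. strict_mono r \<and> weak_star_tendsto (f \<circ> r) l"
proof -
  have C0: "C \<ge> 0" using bnd[of 0] norm_ge_zero order_trans by blast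
  have fb: "\<bar>blinfun_apply (f n) x\<bar> \<le> C * norm x" for n x
    using norm_blinfun[of "f n" x] mult_right_mono[OF bnd[of n] norm_ge_zero[of x]] by simp
  obtain A where A: "countable A" "span (range f) \<subseteq> closure A" using countable_dense_in_span by blast
  obtain e where e: "\<And>g :: 'a \<Rightarrow>\<^sub>L real. norm (e g) \<le> 1 \<and> norm g \<le> 2 * blinfun_apply g (e g)"
    using blinfun_almost_norming by metis
  have eb: "norm (blinfun_apply (f n) x) \<le> C" if "x \<in> e ` A" for n x
    using fb[of n x] e that mult_left_mono[of "norm x" 1 C] C0 by fastforce
  obtain r :: "nat \<Rightarrow> nat" where r: "strict_mono r" "\<And>x. x \<in> e ` A \<Longrightarrow> \<exists>l. (\<lambda>n. blinfun_apply (f (r n)) x) \<longlonglongrightarrow> l"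
  proof (rule function_convergent_subsequence[of "e ` A" "\<lambda>n. blinfun_apply (f n)" C])
    show "countable (e ` A)" using A(1) by (rule countable_image)
  qed (use eb in auto)
  define M where "M = {x. convergent (\<lambda>n. blinfun_apply (f (r n)) x)}"
  have M: "subspace M"
  proof (rule subspaceI)
    show "0 \<in> M" by (simp add: M_def convergent_const)
    show "x + y \<in> M" if "x \<in> M" "y \<in> M" for x y
      using convergent_add that by (simp add: M_def blinfun.add_right)
    show "c *\<^sub>R x \<in> M" if "x \<in> M" for c x
      using convergent_mult[OF convergent_const, of _ c] that by (simp add: M_def blinfun.scaleR_right)
  qed
  have "closed M"
  proof (rule closed_sequential_limits[THEN iffD2], safe)
    fix u x assume u: "\<forall>n. u n \<in> M" "u \<longlonglongrightarrow> x"
    have "Cauchy (\<lambda>n. blinfun_apply (f (r n)) x)"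
    proof (rule metric_CauchyI)
      fix t :: real assume t: "t > 0"
      define s where "s = t / (3 * (C + 1))"
      have s: "s > 0" using t C0 by (simp add: s_def)
      obtain N where "dist (u N) x < s"
        using u(2) s unfolding lim_sequentially by blast
      then have N: "norm (x - u N) < s" by (simp add: dist_norm norm_minus_commute)
      have Cs: "C * s \<le> t / 3" using t C0 by (simp add: s_def field_simps)
      have near: "\<bar>blinfun_apply (f (r n)) x - blinfun_apply (f (r n)) (u N)\<bar> \<le> t / 3" for n
        using fb[of "r n" "x - u N"] mult_left_mono[of "norm (x - u N)" s C] N C0 Cs
        by (simp add: blinfun.diff_right)
      have "Cauchy (\<lambda>n. blinfun_apply (f (r n)) (u N))"
        using u(1) by (simp add: M_def convergent_Cauchy)
      then obtain K where K: "\<And>m n. m \<ge> K \<Longrightarrow> n \<ge> K \<Longrightarrow>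
          dist (blinfun_apply (f (r m)) (u N)) (blinfun_apply (f (r n)) (u N)) < t / 3"
        using metric_CauchyD[of _ "t / 3"] t by (metis divide_pos_pos zero_less_numeral)
      show "\<exists>K. \<forall>m\<ge>K. \<forall>n\<ge>K. dist (blinfun_apply (f (r m)) x) (blinfun_apply (f (r n)) x) < t"
      proof (intro exI allI impI)
        fix m n assume "K \<le> m" "K \<le> n"
        from K[OF this] near[of m] near[of n]
        show "dist (blinfun_apply (f (r m)) x) (blinfun_apply (f (r n)) x) < t"
          unfolding dist_real_def by linarith
      qed
    qed
    then show "x \<in> M" by (simp add: M_def real_Cauchy_convergent)
  qed
  have "x \<in> M" for x
  proof (rule ccontr)
    assume "x \<notin> M"
    then obtain g :: "'a \<Rightarrow>\<^sub>L real" where g: "\<And>y. y \<in> M \<Longrightarrow> blinfun_apply g y = 0" "blinfun_apply g x \<noteq> 0"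
      using annihilating_functional[OF M \<open>closed M\<close>] by blast
    have "g \<in> closure (span (range f))"
    proof (rule ccontr)
      assume "g \<notin> closure (span (range f))"
      then obtain \<phi> :: "('a \<Rightarrow>\<^sub>L real) \<Rightarrow>\<^sub>L real"
        where \<phi>: "\<And>h. h \<in> closure (span (range f)) \<Longrightarrow> blinfun_apply \<phi> h = 0" "blinfun_apply \<phi> g \<noteq> 0"
        using annihilating_functional[of "closure (span (range f))" g] subspace_closure[OF subspace_span] by auto
      obtain z where z: "\<And>h. blinfun_apply \<phi> h = blinfun_apply h z"
        using refl unfolding reflexive_def by blast
      have "blinfun_apply (f n) z = 0" for n
        using \<phi>(1)[of "f n"] z closure_subset[of "span (range f)"] span_base[of "f n" "range f"] by auto
      then have "z \<in> M" by (simp add: M_def convergent_const)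
      then show False using g(1)[of z] \<phi>(2) z by simp
    qed
    then have "g \<in> closure A" using closure_minimal[OF A(2)] by auto
    moreover have g0: "norm g > 0" using g(2) by auto
    ultimately obtain h where h: "h \<in> A" "dist h g < norm g / 3"
      unfolding closure_approachable by (metis divide_pos_pos zero_less_numeral)
    \<comment> \<open>\<open>h\<close> is close to \<open>g\<close>, but \<open>g\<close> vanishes at the point \<open>e h\<close> where \<open>h\<close> is almost normed.\<close>
    have "e h \<in> M" using r(2)[of "e h"] h(1) by (auto simp: M_def convergent_def)
    have "norm h \<le> 2 * blinfun_apply h (e h)" using e by blast
    also have "\<dots> = 2 * blinfun_apply (h - g) (e h)" using g(1)[OF \<open>e h \<in> M\<close>] by (simp add: blinfun.diff_left)
    also have "\<dots> \<le> 2 * norm (h - g)"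
      using norm_blinfun[of "h - g" "e h"] mult_left_mono[of "norm (e h)" 1 "norm (h - g)"] e[of h] by simp
    finally have "norm g \<le> 3 * norm (h - g)"
      using norm_triangle_ineq2[of g h] by (simp add: norm_minus_commute)
    then show False using h(2) by (simp add: dist_norm)
  qed
  then have lim: "(\<lambda>n. blinfun_apply (f (r n)) x) \<longlonglongrightarrow> lim (\<lambda>n. blinfun_apply (f (r n)) x)" for x
    by (simp add: M_def convergent_LIMSEQ_iff)
  let ?L = "\<lambda>x. lim (\<lambda>n. blinfun_apply (f (r n)) x)"
  have "linear ?L"
  proof (rule linearI)
    show "?L (x + y) = ?L x + ?L y" for x y
      using tendsto_add[OF lim[of x] lim[of y]] lim[of "x + y"] LIMSEQ_unique by (auto simp: blinfun.add_right)
    show "?L (c *\<^sub>R x) = c *\<^sub>R ?L x" for c x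
      using tendsto_mult_left[OF lim[of x], of c] lim[of "c *\<^sub>R x"] LIMSEQ_unique
      by (auto simp: blinfun.scaleR_right)
  qed
  moreover have "?L x \<le> C * norm x" for x
    using fb[of _ x] by (intro LIMSEQ_le_const2[OF lim]) (auto simp: abs_le_iff)
  ultimately obtain l where "blinfun_apply l = ?L" using linear_le_norm_blinfun by blast
  then have "weak_star_tendsto (f \<circ> r) l" using lim by (simp add: weak_star_tendsto_def)
  then show ?thesis using r(1) by blast
qed

lemma weak_star_tendstoD: "weak_star_tendsto f l \<Longrightarrow> (\<lambda>k. blinfun_apply (f k) x) \<longlonglongrightarrow> blinfun_apply l x"
  by (simp add: weak_star_tendsto_def)

lemma weak_star_tendsto_subseq:
  assumes "weak_star_tendsto f l" "strict_mono r"
  shows "weak_star_tendsto (f \<circ> r) l"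
  unfolding weak_star_tendsto_def
proof
  fix x
  show "(\<lambda>k. blinfun_apply ((f \<circ> r) k) x) \<longlonglongrightarrow> blinfun_apply l x"
    using LIMSEQ_subseq_LIMSEQ[OF weak_star_tendstoD[OF assms(1), of x] assms(2)] by (simp add: o_def)
qed

lemma weak_star_tendsto_scale:
  assumes "weak_star_tendsto f l"
  shows "weak_star_tendsto (\<lambda>k. c *\<^sub>R f k) (c *\<^sub>R l)"
  unfolding weak_star_tendsto_def
proof
  fix x
  show "(\<lambda>k. blinfun_apply (c *\<^sub>R f k) x) \<longlonglongrightarrow> blinfun_apply (c *\<^sub>R l) x"
    using tendsto_mult_left[OF weak_star_tendstoD[OF assms, of x], of c] by (simp add: blinfun.scaleR_left)
qed

lemma weak_star_norm_le:
  assumes f: "weak_star_tendsto f l" and le: "\<forall>\<^sub>F n in sequentially. norm (f n) \<le> c n"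
    and c: "c \<longlonglongrightarrow> d"
  shows "norm l \<le> d"
proof (rule norm_blinfun_bound)
  have "\<forall>\<^sub>F n in sequentially. 0 \<le> c n"
    using le by (rule eventually_mono) (use norm_ge_zero order_trans in blast)
  then show "0 \<le> d" by (rule tendsto_lowerbound[OF c]) simp
  fix x
  have "(\<lambda>n. norm (blinfun_apply (f n) x)) \<longlonglongrightarrow> norm (blinfun_apply l x)"
    by (intro tendsto_norm weak_star_tendstoD f)
  moreover have "(\<lambda>n. c n * norm x) \<longlonglongrightarrow> d * norm x" by (intro tendsto_mult_right c)
  moreover have "\<forall>\<^sub>F n in sequentially. norm (blinfun_apply (f n) x) \<le> c n * norm x"
    using le
  proof (rule eventually_mono)
    fix n assume "norm (f n) \<le> c n"
    then show "norm (blinfun_apply (f n) x) \<le> c n * norm x"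
      using norm_blinfun[of "f n" x] mult_right_mono[OF _ norm_ge_zero[of x]] order_trans by blast
  qed
  ultimately show "norm (blinfun_apply l x) \<le> d * norm x"
    by (intro tendsto_le[OF sequentially_bot])
qed

text \<open>On the span of a finite set a functional is controlled by its values on that set, with a constant
  that does not depend on the functional. In the induction step a new vector in the closure of the old
  span costs nothing; otherwise its distance \<open>d\<close> to the old span bounds its coefficient by
  \<open>norm x / d\<close>.\<close>

lemma blinfun_bound_on_finite_span:
  fixes B :: "'a::real_normed_vector set"
  assumes "finite B"
  shows "\<exists>C\<ge>0. \<forall>x\<in>span B. \<forall>f::'a \<Rightarrow>\<^sub>L real. \<bar>blinfun_apply f x\<bar> \<le> C * norm x * (\<Sum>b\<in>B. \<bar>blinfun_apply f b\<bar>)"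
  using assms
proof (induction B rule: finite_induct)
  case empty
  then show ?case by (auto intro!: exI[of _ 0])
next
  case (insert b B)
  then obtain C where C: "C \<ge> 0" "\<And>x f. x \<in> span B \<Longrightarrow> \<bar>blinfun_apply f x\<bar> \<le> C * norm x * (\<Sum>b\<in>B. \<bar>blinfun_apply f b\<bar>)"
    by blast
  let ?s = "\<lambda>f. \<Sum>b\<in>B. \<bar>blinfun_apply f b\<bar>"
  have sum: "(\<Sum>b\<in>insert b B. \<bar>blinfun_apply f b\<bar>) = \<bar>blinfun_apply f b\<bar> + ?s f" for f :: "'a \<Rightarrow>\<^sub>L real"
    using insert by simp
  have s0: "?s f \<ge> 0" for f :: "'a \<Rightarrow>\<^sub>L real" by (intro sum_nonneg) auto
  show ?case
  proof (cases "b \<in> closure (span B)")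
    case True
    have bd: "\<bar>blinfun_apply f x\<bar> \<le> C * norm x * ?s f" if x: "x \<in> closure (span B)" for x f
    proof -
      obtain u where u: "\<And>n. u n \<in> span B" "u \<longlonglongrightarrow> x" using x unfolding closure_sequential by blast
      have "(\<lambda>n. \<bar>blinfun_apply f (u n)\<bar>) \<longlonglongrightarrow> \<bar>blinfun_apply f x\<bar>"
        "(\<lambda>n. C * norm (u n) * ?s f) \<longlonglongrightarrow> C * norm x * ?s f"
        by (intro tendsto_rabs blinfun.tendsto tendsto_const u(2),
            intro tendsto_mult_right tendsto_mult_left tendsto_norm u(2))
      then show ?thesis using C(2)[OF u(1)] by (intro LIMSEQ_le) auto
    qed
    have sub: "span (insert b B) \<subseteq> closure (span B)"
      using True closure_subset[of "span B"] span_superset[of B]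
      by (intro span_minimal subspace_closure subspace_span) auto
    have "\<bar>blinfun_apply f x\<bar> \<le> C * norm x * (\<Sum>b\<in>insert b B. \<bar>blinfun_apply f b\<bar>)"
      if "x \<in> span (insert b B)" for x f
    proof -
      have "C * norm x * ?s f \<le> C * norm x * (\<Sum>b\<in>insert b B. \<bar>blinfun_apply f b\<bar>)"
        unfolding sum using C(1) by (intro mult_left_mono) auto
      then show ?thesis using bd[of x f] that sub by fastforce
    qed
    then show ?thesis using C(1) by blast
  next
    case False
    then obtain d where d: "d > 0" "\<And>y. y \<in> span B \<Longrightarrow> d \<le> dist y b"
      unfolding closure_approachable by (meson not_le)
    define K where "K = C * (1 + norm b / d) + 1 / d"
    have K: "K \<ge> 0" "K \<ge> C * (1 + norm b / d)" "K \<ge> 1 / d" using d(1) C(1) by (auto simp: K_def)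
    have "\<bar>blinfun_apply f x\<bar> \<le> K * norm x * (\<bar>blinfun_apply f b\<bar> + ?s f)"
      if x: "x \<in> span (insert b B)" for x f
    proof -
      obtain t where t: "x - t *\<^sub>R b \<in> span B" using x by (auto simp: span_breakdown_eq)
      have tb: "\<bar>t\<bar> * d \<le> norm x"
      proof (cases "t = 0")
        case False
        have "d \<le> dist ((- 1 / t) *\<^sub>R (x - t *\<^sub>R b)) b" using t by (intro d(2) span_scale)
        also have "(- 1 / t) *\<^sub>R (x - t *\<^sub>R b) = b - (1 / t) *\<^sub>R x" using False by (simp add: algebra_simps)
        finally have "d \<le> norm x / \<bar>t\<bar>" by (simp add: dist_norm)
        then show ?thesis using False by (simp add: field_simps)
      qed simp
      then have t': "\<bar>t\<bar> \<le> norm x * (1 / d)" using d(1) by (simp add: field_simps)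
      have "norm (x - t *\<^sub>R b) \<le> norm x + \<bar>t\<bar> * norm b" using norm_triangle_ineq4[of x "t *\<^sub>R b"] by simp
      also have "\<dots> \<le> norm x + norm x * (1 / d) * norm b" using t' by (intro add_left_mono mult_right_mono) auto
      also have "\<dots> = norm x * (1 + norm b / d)" by (simp add: algebra_simps)
      finally have nb: "norm (x - t *\<^sub>R b) \<le> norm x * (1 + norm b / d)" .
      have "\<bar>blinfun_apply f x\<bar> \<le> \<bar>blinfun_apply f (x - t *\<^sub>R b)\<bar> + \<bar>t\<bar> * \<bar>blinfun_apply f b\<bar>"
        by (simp add: blinfun.diff_right blinfun.scaleR_right flip: abs_mult)
      also have "\<dots> \<le> C * (norm x * (1 + norm b / d)) * ?s f + norm x * (1 / d) * \<bar>blinfun_apply f b\<bar>"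
        using C(2)[OF t, of f] mult_right_mono[OF mult_left_mono[OF nb C(1)] s0[of f]] mult_right_mono[OF t', of "\<bar>blinfun_apply f b\<bar>"]
        by linarith
      also have "\<dots> = (C * (1 + norm b / d)) * (norm x * ?s f) + (1 / d) * (norm x * \<bar>blinfun_apply f b\<bar>)"
        by (simp add: algebra_simps)
      also have "\<dots> \<le> K * (norm x * ?s f) + K * (norm x * \<bar>blinfun_apply f b\<bar>)"
        using K s0[of f] by (intro add_mono mult_right_mono) auto
      finally show ?thesis by (simp add: algebra_simps)
    qed
    then show ?thesis using K(1) sum by (intro exI[of _ K]) auto
  qed
qed

lemma weak_star_imp_norm_tendsto_finite_dimensional:
  fixes f :: "nat \<Rightarrow> ('a::real_normed_vector \<Rightarrow>\<^sub>L real)"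
  assumes fin: "finite_dimensional TYPE('a)" and f: "weak_star_tendsto f l"
  shows "f \<longlonglongrightarrow> l"
proof -
  obtain B :: "'a set" where B: "finite B" "span B = UNIV" using fin unfolding finite_dimensional_def by blast
  obtain C where C: "C \<ge> 0" "\<And>x (f :: 'a \<Rightarrow>\<^sub>L real). \<bar>blinfun_apply f x\<bar> \<le> C * norm x * (\<Sum>b\<in>B. \<bar>blinfun_apply f b\<bar>)"
    using blinfun_bound_on_finite_span[OF B(1)] B(2) by auto
  let ?s = "\<lambda>n. C * (\<Sum>b\<in>B. \<bar>blinfun_apply (f n) b - blinfun_apply l b\<bar>)"
  have "norm (f n - l) \<le> ?s n" for n
  proof (rule norm_blinfun_bound)
    show "0 \<le> ?s n" using C(1) by (intro mult_nonneg_nonneg sum_nonneg) auto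
    show "norm (blinfun_apply (f n - l) x) \<le> ?s n * norm x" for x
      using C(2)[of "f n - l" x] by (simp add: blinfun.diff_left mult_ac)
  qed
  moreover have "?s \<longlonglongrightarrow> C * (\<Sum>b\<in>B. \<bar>blinfun_apply l b - blinfun_apply l b\<bar>)"
    using f by (intro tendsto_mult_left tendsto_sum tendsto_rabs tendsto_diff tendsto_const)
      (simp add: weak_star_tendsto_def)
  then have "?s \<longlonglongrightarrow> 0" by simp
  ultimately have "(\<lambda>n. f n - l) \<longlonglongrightarrow> 0"
    using Lim_null_comparison[of "\<lambda>n. f n - l" ?s sequentially] by simp
  then show ?thesis by (simp add: LIM_zero_iff)
qed

section \<open>Differentiability of the norm\<close>

text \<open>The squared norm is Frechet differentiable everywhere when the dual space is locally uniformly
  convex. Twice a duality mapping \<open>J\<close> is a selection of its subdifferential, so the linearisation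
  error at \<open>a\<close> is squeezed between \<open>0\<close> and \<open>2 \<langle>J y - J a, y - a\<rangle>\<close>, and it remains to see that \<open>J\<close> is
  continuous. If \<open>u n\<close> tends to \<open>a \<noteq> 0\<close>, then the norming functionals satisfy
  \<open>norm (N a + N (u n)) \<longlonglongrightarrow> 2\<close>, because the sum is almost \<open>2 norm a\<close> at the point \<open>a\<close>.\<close>

lemma norm_sq_has_derivative:
  fixes a :: "'a::real_normed_vector"
  assumes luc: "locally_uniformly_convex TYPE('a \<Rightarrow>\<^sub>L real)"
  shows "\<exists>F\<in>duality_map a. ((\<lambda>v. (norm v)\<^sup>2) has_derivative (\<lambda>h. 2 * blinfun_apply F h)) (at a)"
proof (cases "a = 0")
  case True
  have "((\<lambda>v::'a. (norm v)\<^sup>2) has_derivative (\<lambda>h. 0)) (at 0)"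
  proof (rule has_derivativeI_sandwich[where e = 1 and H = norm])
    show "norm ((norm y)\<^sup>2 - (norm (0::'a))\<^sup>2 - 0) / norm (y - 0) \<le> norm y" for y :: 'a
      by (simp add: power2_eq_square)
    show "(norm \<longlongrightarrow> 0) (at (0::'a))" by (rule tendsto_norm_zero) (rule tendsto_ident_at)
  qed auto
  then show ?thesis using True by (intro bexI[of _ 0]) (auto simp: duality_map_def)
next
  case False
  \<comment> \<open>At \<open>u = 0\<close> any functional of norm one will do, and \<open>a \<noteq> 0\<close> provides one.\<close>
  have "\<exists>g::'a \<Rightarrow>\<^sub>L real. norm g = 1 \<and> blinfun_apply g u = norm u" for u
    using norming_functional[of u] norming_functional[OF False] by (cases "u = 0") auto
  then obtain N :: "'a \<Rightarrow> ('a \<Rightarrow>\<^sub>L real)" where N: "\<And>u. norm (N u) = 1" "\<And>u. blinfun_apply (N u) u = norm u"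
    by metis
  have Nle: "blinfun_apply (N u) v \<le> norm v" for u v
    using norm_blinfun[of "N u" v] N(1)[of u] by simp
  have "(N \<longlongrightarrow> N a) (at a)"
    unfolding tendsto_at_iff_sequentially
  proof (intro allI impI)
    fix u :: "nat \<Rightarrow> 'a" assume u: "u \<longlonglongrightarrow> a"
    have low: "(norm a + norm (u n) - norm (a - u n)) / norm a \<le> norm (N a + N (u n))" for n
    proof -
      have "norm a + norm (u n) - norm (a - u n) \<le> blinfun_apply (N a) a + blinfun_apply (N (u n)) (u n) - blinfun_apply (N (u n)) (u n - a)"
        using Nle[of "u n" "u n - a"] by (simp add: N norm_minus_commute)
      also have "\<dots> = blinfun_apply (N a + N (u n)) a" by (simp add: blinfun.diff_right blinfun.add_left)
      also have "\<dots> \<le> norm (N a + N (u n)) * norm a"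
        using norm_blinfun[of "N a + N (u n)" a] by simp
      finally show ?thesis using False by (simp add: field_simps)
    qed
    have "(\<lambda>n. (norm a + norm (u n) - norm (a - u n)) / norm a) \<longlonglongrightarrow> (norm a + norm a - norm (a - a)) / norm a"
      using u False by (intro tendsto_intros) auto
    also have "(norm a + norm a - norm (a - a)) / norm a = 2" using False by simp
    finally have "(\<lambda>n. norm (N a + N (u n))) \<longlonglongrightarrow> 2"
    proof (rule real_tendsto_sandwich[rotated 2])
      show "(\<lambda>n. 2 :: real) \<longlonglongrightarrow> 2" by simp
      show "\<forall>\<^sub>F n in sequentially. (norm a + norm (u n) - norm (a - u n)) / norm a \<le> norm (N a + N (u n))"
        using low by simp
      have "norm (N a + N (u n)) \<le> 2" for n using norm_triangle_ineq[of "N a" "N (u n)"] N(1) by simp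
      then show "\<forall>\<^sub>F n in sequentially. norm (N a + N (u n)) \<le> 2" by simp
    qed
    then show "(N \<circ> u) \<longlonglongrightarrow> N a"
      using luc[unfolded locally_uniformly_convex_def, rule_format, of "N a" "\<lambda>n. N (u n)"] N(1)
      by (simp add: o_def)
  qed
  define J where "J u = norm u *\<^sub>R N u" for u
  have "(J \<longlongrightarrow> J a) (at a)" unfolding J_def by (intro tendsto_intros \<open>(N \<longlongrightarrow> N a) (at a)\<close>)
  then have J0: "((\<lambda>u. 2 * norm (J u - J a)) \<longlongrightarrow> 0) (at a)"
    by (intro tendsto_mult_right_zero tendsto_norm_zero) (simp add: LIM_zero)
  have grad: "2 * blinfun_apply (J u) (v - u) \<le> (norm v)\<^sup>2 - (norm u)\<^sup>2" for u v
  proof -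
    have "2 * blinfun_apply (J u) v \<le> 2 * (norm u * norm v)"
      using Nle[of u v] by (auto simp: J_def blinfun.scaleR_left intro: mult_left_mono)
    also have "\<dots> \<le> (norm u)\<^sup>2 + (norm v)\<^sup>2" using sum_squares_bound[of "norm u" "norm v"] by simp
    finally show ?thesis by (simp add: blinfun.diff_right J_def blinfun.scaleR_left N power2_eq_square)
  qed
  have "((\<lambda>v. (norm v)\<^sup>2) has_derivative (\<lambda>h. 2 * blinfun_apply (J a) h)) (at a)"
  proof (rule has_derivativeI_sandwich[where e = 1 and H = "\<lambda>u. 2 * norm (J u - J a)"])
    show "bounded_linear (\<lambda>h. 2 * blinfun_apply (J a) h)"
      by (intro bounded_linear_const_mult blinfun.bounded_linear_right)
    fix y assume y: "y \<noteq> a"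
    let ?q = "(norm y)\<^sup>2 - (norm a)\<^sup>2 - 2 * blinfun_apply (J a) (y - a)"
    have "?q \<ge> 0" using grad[of a y] by simp
    moreover have "?q \<le> 2 * blinfun_apply (J y - J a) (y - a)"
      using grad[of y a] by (simp add: blinfun.diff_left blinfun.diff_right)
    moreover have "\<dots> \<le> 2 * (norm (J y - J a) * norm (y - a))"
      using norm_blinfun[of "J y - J a" "y - a"] by simp
    ultimately have "norm ?q \<le> 2 * norm (J y - J a) * norm (y - a)" by simp
    then show "norm ?q / norm (y - a) \<le> 2 * norm (J y - J a)"
      using y by (simp add: field_simps)
  qed (use J0 in auto)
  moreover have "J a \<in> duality_map a"
    by (simp add: duality_map_def J_def N blinfun.scaleR_left power2_eq_square)
  ultimately show ?thesis by blast
qed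

section \<open>Ekeland's variational principle\<close>

lemma ekeland:
  fixes f :: "'a::complete_space \<Rightarrow> real"
  assumes A: "closed A" "a \<in> A" and f: "continuous_on A f" and nonneg: "\<And>x. x \<in> A \<Longrightarrow> 0 \<le> f x" and d: "d > 0"
  shows "\<exists>w\<in>A. f w + d * dist a w \<le> f a \<and> (\<forall>u\<in>A. f w \<le> f u + d * dist w u)"
proof -
  \<comment> \<open>\<open>S x\<close> collects the points that improve on \<open>x\<close> by at least \<open>d\<close> times their distance from \<open>x\<close>;
      each iterate almost minimises \<open>f\<close> on the set of the previous one.\<close>
  define S where "S x = {u \<in> A. f u + d * dist x u \<le> f x}" for x
  have refl: "x \<in> S x" if "x \<in> A" for x using that by (simp add: S_def)
  have trans: "u \<in> S x" if "u \<in> S y" "y \<in> S x" for u x y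
    using that d dist_triangle[of x u y] mult_left_mono[of "dist x u" "dist x y + dist y u" d]
    by (auto simp: S_def algebra_simps)
  have next_ex: "\<exists>y\<in>S x. \<forall>u\<in>S x. f y \<le> f u + (1/2) ^ n" if xA: "x \<in> A" for x n
  proof -
    have bdd: "bdd_below (f ` S x)" by (intro bdd_belowI2[of _ 0]) (auto simp: S_def nonneg)
    have "Inf (f ` S x) < Inf (f ` S x) + (1/2) ^ n" by simp
    then obtain y where y: "y \<in> S x" "f y < Inf (f ` S x) + (1/2) ^ n"
      using cInf_lessD[of "f ` S x"] refl[OF xA] by blast
    then have "f y \<le> f u + (1/2) ^ n" if "u \<in> S x" for u
      using cINF_lower[OF bdd that] by simp
    then show ?thesis using y by blast
  qed
  obtain x where x: "x 0 = a" "\<And>n. x n \<in> A" "\<And>n. x (Suc n) \<in> S (x n)"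
    "\<And>n u. u \<in> S (x n) \<Longrightarrow> f (x (Suc n)) \<le> f u + (1/2) ^ n"
  proof -
    have "\<exists>x. \<forall>n. (x n \<in> A \<and> (n = 0 \<longrightarrow> x n = a)) \<and>
        x (Suc n) \<in> S (x n) \<and> (\<forall>u\<in>S (x n). f (x (Suc n)) \<le> f u + (1/2) ^ n)"
    proof (rule dependent_nat_choice)
      show "\<exists>x. x \<in> A \<and> ((0::nat) = 0 \<longrightarrow> x = a)" using A(2) by blast
    next
      fix y n assume "y \<in> A \<and> (n = (0::nat) \<longrightarrow> y = a)"
      then show "\<exists>z. (z \<in> A \<and> (Suc n = 0 \<longrightarrow> z = a)) \<and> z \<in> S y \<and> (\<forall>u\<in>S y. f z \<le> f u + (1/2) ^ n)"
        using next_ex[of y n] by (auto simp: S_def)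
    qed
    then show ?thesis using that by blast
  qed
  have mono: "x m \<in> S (x n)" if "n \<le> m" for m n
    using that by (induction m rule: dec_induct) (use refl x(2,3) trans in blast)+
  have desc: "d * dist (x n) (x m) \<le> f (x n) - f (x m)" if "n \<le> m" for n m
    using mono[OF that] by (simp add: S_def)
  have dec: "decseq (\<lambda>n. f (x n))"
    unfolding decseq_def
  proof (intro allI impI)
    fix m n :: nat assume "m \<le> n"
    from desc[OF this] d show "f (x n) \<le> f (x m)" using mult_nonneg_nonneg[of d "dist (x m) (x n)"] by (smt (verit) zero_le_dist)
  qed
  have "Cauchy (\<lambda>n. f (x n))"
    using decseq_convergent[OF dec, of 0] nonneg x(2) by (meson LIMSEQ_imp_Cauchy)
  have "Cauchy x"
  proof (rule metric_CauchyI)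
    fix e :: real assume e: "e > 0"
    then obtain K where K: "\<And>m n. m \<ge> K \<Longrightarrow> n \<ge> K \<Longrightarrow> dist (f (x m)) (f (x n)) < d * e"
      using metric_CauchyD[OF \<open>Cauchy (\<lambda>n. f (x n))\<close>, of "d * e"] d by (metis mult_pos_pos)
    have *: "dist (x n) (x m) < e" if "K \<le> n" "n \<le> m" for m n
    proof -
      have "d * dist (x n) (x m) < d * e" using desc[OF that(2)] K[of n m] that by (simp add: dist_real_def)
      then show ?thesis using d by simp
    qed
    show "\<exists>M. \<forall>m\<ge>M. \<forall>n\<ge>M. dist (x m) (x n) < e"
      using * by (metis dist_commute nle_le)
  qed
  then obtain w where w: "x \<longlonglongrightarrow> w" using Cauchy_convergent_iff convergent_def by blast
  have wA: "w \<in> A" using closed_sequentially[OF A(1) x(2) w] .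
  have fw: "(\<lambda>n. f (x n)) \<longlonglongrightarrow> f w"
    using continuous_on_tendsto_compose[OF f w wA] x(2) by simp
  have wS: "w \<in> S (x n)" for n
  proof -
    have "(\<lambda>m. f (x m) + d * dist (x n) (x m)) \<longlonglongrightarrow> f w + d * dist (x n) w"
      by (intro tendsto_intros fw w)
    then have "f w + d * dist (x n) w \<le> f (x n)"
      by (rule LIMSEQ_le_const2) (use mono in \<open>auto simp: S_def\<close>)
    then show ?thesis using wA by (simp add: S_def)
  qed
  have "f w \<le> f u + d * dist w u" if u: "u \<in> A" for u
  proof (rule ccontr)
    assume "\<not> ?thesis"
    then have less: "f u + d * dist w u < f w" by simp
    then have "u \<in> S w" using u by (simp add: S_def)
    then have "f (x (Suc n)) \<le> f u + (1/2) ^ n" for n using x(4) trans wS by blast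
    moreover have "(\<lambda>n. f (x (Suc n))) \<longlonglongrightarrow> f w" using fw by (rule LIMSEQ_Suc)
    moreover have "(\<lambda>n. f u + (1/2) ^ n) \<longlonglongrightarrow> f u + 0"
      by (intro tendsto_intros LIMSEQ_realpow_zero) auto
    ultimately have "f w \<le> f u + 0" by (intro LIMSEQ_le) auto
    moreover have "0 \<le> d * dist w u" using d by simp
    ultimately show False using less by linarith
  qed
  then show ?thesis using wA wS[of 0] x(1) by (auto simp: S_def)
qed

section \<open>Tangents, duality mappings and normals\<close>

lemma eps_normals_iff:
  "f \<in> eps_normals \<epsilon> x A \<longleftrightarrow>
     (\<forall>c>\<epsilon>. \<forall>\<^sub>F u in at x within A. blinfun_apply f (u - x) \<le> c * norm (u - x))"
proof
  assume "f \<in> eps_normals \<epsilon> x A"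
  then have "\<forall>c>ereal \<epsilon>. \<forall>\<^sub>F u in at x within A. ereal (blinfun_apply f (u - x) / norm (u - x)) < c"
    unfolding eps_normals_def mem_Collect_eq Limsup_le_iff .
  from this[rule_format, of "ereal c" for c]
  have ev: "\<forall>\<^sub>F u in at x within A. blinfun_apply f (u - x) / norm (u - x) < c" if "c > \<epsilon>" for c
    using that by simp
  show "\<forall>c>\<epsilon>. \<forall>\<^sub>F u in at x within A. blinfun_apply f (u - x) \<le> c * norm (u - x)"
  proof (intro allI impI)
    fix c assume "c > \<epsilon>"
    show "\<forall>\<^sub>F u in at x within A. blinfun_apply f (u - x) \<le> c * norm (u - x)"
      using ev[OF \<open>c > \<epsilon>\<close>] eventually_neq_at_within[of x]
      by eventually_elim (simp add: pos_divide_less_eq less_imp_le)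
  qed
next
  assume H: "\<forall>c>\<epsilon>. \<forall>\<^sub>F u in at x within A. blinfun_apply f (u - x) \<le> c * norm (u - x)"
  show "f \<in> eps_normals \<epsilon> x A"
    unfolding eps_normals_def mem_Collect_eq Limsup_le_iff
  proof (intro allI impI)
    fix y :: ereal assume y: "ereal \<epsilon> < y"
    then obtain c where c: "ereal \<epsilon> < ereal c" "ereal c < y" using ereal_dense2 by blast
    from H c(1) have "\<forall>\<^sub>F u in at x within A. blinfun_apply f (u - x) \<le> c * norm (u - x)" by simp
    then show "\<forall>\<^sub>F u in at x within A. ereal (blinfun_apply f (u - x) / norm (u - x)) < y"
      using eventually_neq_at_within[of x]
    proof eventually_elim
      case (elim u)
      then have "ereal (blinfun_apply f (u - x) / norm (u - x)) \<le> ereal c"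
        by (simp add: pos_divide_le_eq)
      then show ?case using c(2) by (rule le_less_trans)
    qed
  qed
qed

lemma eps_normals_scale:
  assumes f: "f \<in> eps_normals \<epsilon> x A" and c: "c > 0"
  shows "c *\<^sub>R f \<in> eps_normals (c * \<epsilon>) x A"
  unfolding eps_normals_iff
proof (intro allI impI)
  fix d assume "d > c * \<epsilon>"
  then have "d / c > \<epsilon>" using c by (simp add: field_simps)
  then have "\<forall>\<^sub>F u in at x within A. blinfun_apply f (u - x) \<le> d / c * norm (u - x)"
    using f unfolding eps_normals_iff by blast
  then show "\<forall>\<^sub>F u in at x within A. blinfun_apply (c *\<^sub>R f) (u - x) \<le> d * norm (u - x)"
    by eventually_elim (use c in \<open>simp add: blinfun.scaleR_left field_simps\<close>)
qed

lemma zero_eps_normal: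
  assumes "\<epsilon> \<ge> 0"
  shows "0 \<in> eps_normals \<epsilon> x A"
  unfolding eps_normals_iff
proof (intro allI impI always_eventually)
  fix c u assume "c > \<epsilon>"
  then show "blinfun_apply 0 (u - x) \<le> c * norm (u - x)" using assms by simp
qed

text \<open>If \<open>p\<close> minimises \<open>g\<close> up to the perturbation \<open>\<delta> * norm (q - p)\<close> on the part of \<open>A\<close> in a neighbourhood
  \<open>C\<close> of \<open>p\<close>, then minus the derivative of \<open>g\<close> at \<open>p\<close> is a \<open>\<delta>\<close>-normal to \<open>A\<close>.\<close>

lemma perturbed_minimum_eps_normal:
  assumes g: "(g has_derivative blinfun_apply D) (at p)" and p: "p \<in> interior C"
    and min: "\<And>q. q \<in> A \<inter> C \<Longrightarrow> g p \<le> g q + \<delta> * norm (q - p)"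
  shows "- D \<in> eps_normals \<delta> p A"
  unfolding eps_normals_iff
proof (intro allI impI)
  fix c assume "c > \<delta>"
  then obtain d1 where d1: "d1 > 0"
    "\<And>q. norm (q - p) < d1 \<Longrightarrow> norm (g q - g p - blinfun_apply D (q - p)) \<le> (c - \<delta>) * norm (q - p)"
    using g unfolding has_derivative_at_alt by (meson diff_gt_0_iff_gt)
  obtain d2 where d2: "d2 > 0" "ball p d2 \<subseteq> C" using p unfolding mem_interior by blast
  show "\<forall>\<^sub>F u in at p within A. blinfun_apply (- D) (u - p) \<le> c * norm (u - p)"
    unfolding eventually_at
  proof (intro exI[of _ "min d1 d2"] conjI ballI impI)
    show "min d1 d2 > 0" using d1 d2 by simp
    fix q assume q: "q \<in> A" "q \<noteq> p \<and> dist q p < min d1 d2"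
    then have "q \<in> A \<inter> C" using d2 by (auto simp: dist_commute)
    from min[OF this] d1(2)[of q] q show "blinfun_apply (- D) (q - p) \<le> c * norm (q - p)"
      by (simp add: dist_norm blinfun.minus_left abs_le_iff algebra_simps)
  qed
qed

lemma contingent_cone_scale:
  assumes w: "w \<in> contingent_cone x \<Omega>" and c: "c > 0"
  shows "c *\<^sub>R w \<in> contingent_cone x \<Omega>"
proof -
  obtain t u where tu: "decreases_to_0 t" "u \<longlonglongrightarrow> w" "\<And>k. x + t k *\<^sub>R u k \<in> \<Omega>"
    using w unfolding contingent_cone_def by blast
  have "decreases_to_0 (\<lambda>k. t k / c)"
    using tu(1) c tendsto_divide[of t 0 sequentially "\<lambda>_. c" c] by (auto simp: decreases_to_0_def)
  moreover have "(\<lambda>k. c *\<^sub>R u k) \<longlonglongrightarrow> c *\<^sub>R w" by (intro tendsto_intros tu)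
  moreover have "x + (t k / c) *\<^sub>R (c *\<^sub>R u k) \<in> \<Omega>" for k using tu(3)[of k] c by simp
  ultimately show ?thesis unfolding contingent_cone_def by blast
qed

lemma convex_contingent_cone:
  assumes "convex \<Omega>" "x \<in> \<Omega>" "z \<in> \<Omega>" "c \<ge> 0"
  shows "c *\<^sub>R (z - x) \<in> contingent_cone x \<Omega>"
proof -
  define t where "t k = inverse (c + 1) * inverse (real (Suc k))" for k
  have t: "0 < t k" for k using assms(4) by (simp add: t_def)
  have "t \<longlonglongrightarrow> inverse (c + 1) * 0"
    unfolding t_def by (intro tendsto_intros LIMSEQ_inverse_real_of_nat)
  then have "decreases_to_0 t" using t by (simp add: decreases_to_0_def)
  moreover have "x + t k *\<^sub>R (c *\<^sub>R (z - x)) \<in> \<Omega>" for k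
  proof -
    have "inverse (c + 1) * c \<le> 1" using assms(4) by (simp add: field_simps)
    moreover have "inverse (real (Suc k)) \<le> 1" by (simp add: field_simps)
    ultimately have "(inverse (c + 1) * c) * inverse (real (Suc k)) \<le> 1 * 1"
      using assms(4) by (intro mult_mono) auto
    then have "t k * c \<le> 1" by (simp add: t_def mult_ac)
    moreover have "0 \<le> t k * c" using t[of k] assms(4) by simp
    ultimately have "(1 - t k * c) *\<^sub>R x + (t k * c) *\<^sub>R z \<in> \<Omega>"
      using assms by (intro convexD) auto
    then show ?thesis by (simp add: algebra_simps)
  qed
  ultimately show ?thesis
    unfolding contingent_cone_def by (intro CollectI exI[of _ t] exI[of _ "\<lambda>_. c *\<^sub>R (z - x)"]) auto
qed

lemma duality_map_scale: "F \<in> duality_map a \<Longrightarrow> c \<ge> 0 \<Longrightarrow> c *\<^sub>R F \<in> duality_map (c *\<^sub>R a)"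
  by (simp add: duality_map_def blinfun.scaleR_left blinfun.scaleR_right power2_eq_square)

lemma duality_map_minus: "F \<in> duality_map a \<Longrightarrow> - F \<in> duality_map (- a)"
  by (simp add: duality_map_def blinfun.minus_left blinfun.minus_right)

lemma dual_pair_scale: "c *\<^sub>R dual_pair f g = dual_pair (c *\<^sub>R f) (c *\<^sub>R g)"
  by (rule blinfun_eqI) (auto simp: dual_pair_apply blinfun.scaleR_left algebra_simps)

lemma dual_pair_minus: "- dual_pair f g = dual_pair (- f) (- g)"
  by (rule blinfun_eqI) (auto simp: dual_pair_apply blinfun.minus_left)

lemma mem_gph_restr: "(x, y) \<in> gph (restr S \<Omega> \<Theta>) \<longleftrightarrow> x \<in> \<Omega> \<and> y \<in> S x \<and> y \<in> \<Theta>"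
  by (auto simp: gph_def restr_def)

lemma duality_contingent_cone_scale:
  assumes "f \<in> (\<Union>v\<in>contingent_cone x \<Omega>. duality_map v)" and c: "c > 0"
  shows "c *\<^sub>R f \<in> (\<Union>v\<in>contingent_cone x \<Omega>. duality_map v)"
proof -
  obtain v where "v \<in> contingent_cone x \<Omega>" "f \<in> duality_map v" using assms(1) by blast
  then show ?thesis
    using contingent_cone_scale[OF _ c] duality_map_scale[of f v c] c by (intro UN_I[of "c *\<^sub>R v"]) auto
qed

lemma zero_in_duality_contingent_cone:
  assumes "x \<in> \<Omega>"
  shows "0 \<in> (\<Union>v\<in>contingent_cone x \<Omega>. duality_map v)"
proof (rule UN_I)
  have "decreases_to_0 (\<lambda>k. inverse (real (Suc k)))"
    using LIMSEQ_inverse_real_of_nat by (simp add: decreases_to_0_def)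
  then show "0 \<in> contingent_cone x \<Omega>"
    unfolding contingent_cone_def using assms
    by (intro CollectI exI[of _ "\<lambda>k. inverse (real (Suc k))"] exI[of _ "\<lambda>_. 0"]) auto
qed (simp add: duality_map_def)

lemma contingent_normal_pair_scale:
  assumes n: "contingent_normal_pair S \<Omega> \<Theta> \<epsilon> x y xs zs" and c: "c > 0"
  shows "contingent_normal_pair S \<Omega> \<Theta> (c * \<epsilon>) x y (c *\<^sub>R xs) (c *\<^sub>R zs)"
  unfolding contingent_normal_pair_def
proof (intro conjI)
  show "(x, y) \<in> gph (restr S \<Omega> \<Theta>)" using n by (simp add: contingent_normal_pair_def)
  have "c *\<^sub>R dual_pair xs zs \<in> eps_normals (c * \<epsilon>) (x, y) (gph (restr S \<Omega> \<Theta>))"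
    using n c by (intro eps_normals_scale) (simp add: contingent_normal_pair_def)
  then show "dual_pair (c *\<^sub>R xs) (c *\<^sub>R zs) \<in> eps_normals (c * \<epsilon>) (x, y) (gph (restr S \<Omega> \<Theta>))"
    by (simp add: dual_pair_scale)
  show "c *\<^sub>R xs \<in> (\<Union>v\<in>contingent_cone x \<Omega>. duality_map v)"
    using n c by (intro duality_contingent_cone_scale) (simp add: contingent_normal_pair_def)
  show "c *\<^sub>R zs \<in> (\<Union>w\<in>contingent_cone y \<Theta>. duality_map w)"
    using n c by (intro duality_contingent_cone_scale) (simp add: contingent_normal_pair_def)
qed

section \<open>The relative Lipschitz-like property bounds contingent normals\<close>

text \<open>Moving from \<open>x\<close> to \<open>x + t u\<close>, where \<open>u\<close> approximates the tangent direction \<open>w\<close>, the Lipschitz-like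
  property keeps a point \<open>v\<close> of the graph within \<open>\<kappa> t norm u\<close> of \<open>y\<close>. Testing the \<open>\<epsilon>\<close>-normal along these
  points bounds \<open>\<langle>x\<^sup>*, w\<rangle>\<close>, and \<open>x\<^sup>* \<in> J w\<close> turns \<open>\<langle>x\<^sup>*, w\<rangle>\<close> into \<open>norm x\<^sup>* * norm w\<close>.\<close>

lemma lipschitz_like_normal_bound:
  assumes "lipschitz_like_const S \<Omega> \<Theta> xb yb \<kappa>"
  shows "\<exists>V W. open V \<and> xb \<in> V \<and> open W \<and> yb \<in> W \<and>
     (\<forall>\<epsilon> x y xs zs. \<epsilon> \<ge> 0 \<longrightarrow> x \<in> V \<longrightarrow> y \<in> W \<longrightarrow> contingent_normal_pair S \<Omega> \<Theta> \<epsilon> x y xs zs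
        \<longrightarrow> norm xs \<le> \<kappa> * norm zs + \<epsilon> * (1 + \<kappa>))"
proof -
  obtain V W where \<kappa>: "\<kappa> \<ge> 0" and VW: "open V" "xb \<in> V" "open W" "yb \<in> W"
    and lip: "\<And>x x'. x \<in> \<Omega> \<inter> V \<Longrightarrow> x' \<in> \<Omega> \<inter> V \<Longrightarrow>
           (S x' \<inter> \<Theta>) \<inter> W \<subseteq> (S x \<inter> \<Theta>) + (\<lambda>b. (\<kappa> * norm (x' - x)) *\<^sub>R b) ` cball 0 1"
    using assms unfolding lipschitz_like_const_def by blast
  have "norm xs \<le> \<kappa> * norm zs + \<epsilon> * (1 + \<kappa>)"
    if \<epsilon>: "\<epsilon> \<ge> 0" and x: "x \<in> V" and y: "y \<in> W" and n: "contingent_normal_pair S \<Omega> \<Theta> \<epsilon> x y xs zs"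
    for \<epsilon> x y xs zs
  proof -
    let ?G = "gph (restr S \<Omega> \<Theta>)"
    have xy: "x \<in> \<Omega>" "y \<in> S x" "y \<in> \<Theta>"
      and normal: "dual_pair xs zs \<in> eps_normals \<epsilon> (x, y) ?G"
      using n by (auto simp: contingent_normal_pair_def mem_gph_restr)
    obtain w where w: "w \<in> contingent_cone x \<Omega>" "xs \<in> duality_map w"
      using n by (auto simp: contingent_normal_pair_def)
    then have xsw: "blinfun_apply xs w = norm w * norm w" "norm xs = norm w"
      by (auto simp: duality_map_def power2_eq_square)
    obtain t u where t: "\<And>k. t k > 0" "t \<longlonglongrightarrow> 0" and u: "u \<longlonglongrightarrow> w"
      and tu: "\<And>k. x + t k *\<^sub>R u k \<in> \<Omega>"
      using w(1) unfolding contingent_cone_def decreases_to_0_def by blast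
    have bound: "norm w \<le> \<kappa> * norm zs + c * (1 + \<kappa>)" if c: "c > \<epsilon>" for c
    proof -
      obtain d where d: "d > 0" and
        nd: "\<And>q. q \<in> ?G \<Longrightarrow> q \<noteq> (x, y) \<Longrightarrow> dist q (x, y) < d \<Longrightarrow>
               blinfun_apply (dual_pair xs zs) (q - (x, y)) \<le> c * norm (q - (x, y))"
        using normal c unfolding eps_normals_iff eventually_at by blast
      have lim0: "(\<lambda>k. t k *\<^sub>R u k) \<longlonglongrightarrow> 0" using tendsto_scaleR[OF t(2) u] by simp
      then have "(\<lambda>k. x + t k *\<^sub>R u k) \<longlonglongrightarrow> x" using tendsto_add[OF tendsto_const lim0, of x] by simp
      then have evV: "\<forall>\<^sub>F k in sequentially. x + t k *\<^sub>R u k \<in> V"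
        using VW(1) x by (rule topological_tendstoD)
      have "(\<lambda>k. (1 + \<kappa>) * norm (t k *\<^sub>R u k)) \<longlonglongrightarrow> 0"
        using lim0 by (intro tendsto_mult_right_zero tendsto_norm_zero)
      then have evd: "\<forall>\<^sub>F k in sequentially. (1 + \<kappa>) * norm (t k *\<^sub>R u k) < d"
        using d by (rule order_tendstoD)
      have "\<forall>\<^sub>F k in sequentially. blinfun_apply xs (u k) \<le> (\<kappa> * norm zs + c * (1 + \<kappa>)) * norm (u k)"
        using evV evd
      proof eventually_elim
        case (elim k)
        let ?h = "t k *\<^sub>R u k"
        have "y \<in> (S (x + ?h) \<inter> \<Theta>) + (\<lambda>b. (\<kappa> * norm (x - (x + ?h))) *\<^sub>R b) ` cball 0 1"
          using lip[of "x + ?h" x] elim(1) tu[of k] x xy y by blast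
        then obtain v b where v: "v \<in> S (x + ?h)" "v \<in> \<Theta>" and b: "norm b \<le> 1"
          and y_eq: "y = v + (\<kappa> * norm ?h) *\<^sub>R b"
          by (auto simp: set_plus_def)
        have "norm (v - y) = (\<kappa> * norm ?h) * norm b"
          using y_eq \<kappa> by (simp add: abs_mult)
        then have vy: "norm (v - y) \<le> \<kappa> * norm ?h"
          using mult_left_mono[OF b, of "\<kappa> * norm ?h"] \<kappa> by simp
        have nq: "norm (?h, v - y) \<le> (1 + \<kappa>) * norm ?h"
          using norm_Pair_le[of ?h "v - y"] vy by (simp add: algebra_simps)
        have "blinfun_apply (dual_pair xs zs) (?h, v - y) \<le> c * norm (?h, v - y)"
        proof (cases "(x + ?h, v) = (x, y)")
          case True
          then have "(?h, v - y) = 0" by (simp add: zero_prod_def)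
          then show ?thesis by simp
        next
          case False
          have "dist (x + ?h, v) (x, y) < d" using nq elim(2) by (simp add: dist_norm)
          with nd[of "(x + ?h, v)"] False v tu[of k] show ?thesis
            by (simp add: mem_gph_restr)
        qed
        also have "\<dots> \<le> c * ((1 + \<kappa>) * norm ?h)"
          using nq c \<epsilon> by (intro mult_left_mono) auto
        finally have "blinfun_apply xs ?h + blinfun_apply zs (v - y) \<le> c * ((1 + \<kappa>) * norm ?h)"
          by (simp add: dual_pair_apply)
        moreover have "- blinfun_apply zs (v - y) \<le> norm zs * (\<kappa> * norm ?h)"
          using norm_blinfun[of zs "v - y"] mult_left_mono[OF vy norm_ge_zero[of zs]] by simp
        ultimately have "blinfun_apply xs ?h \<le> (\<kappa> * norm zs + c * (1 + \<kappa>)) * norm ?h"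
          by (simp add: algebra_simps)
        then have "t k * blinfun_apply xs (u k) \<le> t k * ((\<kappa> * norm zs + c * (1 + \<kappa>)) * norm (u k))"
          using t(1)[of k] by (simp add: blinfun.scaleR_right mult_ac)
        then show ?case using t(1)[of k] by simp
      qed
      moreover have "(\<lambda>k. blinfun_apply xs (u k)) \<longlonglongrightarrow> blinfun_apply xs w"
        by (intro blinfun.tendsto tendsto_const u)
      moreover have "(\<lambda>k. (\<kappa> * norm zs + c * (1 + \<kappa>)) * norm (u k))
          \<longlonglongrightarrow> (\<kappa> * norm zs + c * (1 + \<kappa>)) * norm w"
        by (intro tendsto_mult_left tendsto_norm u)
      ultimately have "norm w * norm w \<le> (\<kappa> * norm zs + c * (1 + \<kappa>)) * norm w"
        unfolding xsw(1)[symmetric] by (intro tendsto_le[OF sequentially_bot])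
      then show ?thesis
        using \<kappa> c \<epsilon> by (cases "w = 0") (auto intro!: add_nonneg_nonneg mult_nonneg_nonneg)
    qed
    show ?thesis
    proof (rule field_le_epsilon)
      fix e :: real assume e: "e > 0"
      have "norm w \<le> \<kappa> * norm zs + (\<epsilon> + e / (1 + \<kappa>)) * (1 + \<kappa>)"
        using e \<kappa> by (intro bound) (auto intro!: divide_pos_pos)
      also have "(\<epsilon> + e / (1 + \<kappa>)) * (1 + \<kappa>) = \<epsilon> * (1 + \<kappa>) + e" using \<kappa> by (simp add: distrib_right)
      finally show "norm xs \<le> \<kappa> * norm zs + \<epsilon> * (1 + \<kappa>) + e" using xsw by simp
    qed
  qed
  then show ?thesis using VW by blast
qed

lemma lipschitz_like_sequence_bound:
  assumes lip: "lipschitz_like_const S \<Omega> \<Theta> xb yb \<kappa>"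
    and \<epsilon>: "decreases_to_0 \<epsilon>" and xy: "(\<lambda>k. (x k, y k)) \<longlonglongrightarrow> (xb, yb)"
    and n: "\<And>k. contingent_normal_pair S \<Omega> \<Theta> (\<epsilon> k) (x k) (y k) (xs k) (- ys k)"
  shows "\<forall>\<^sub>F k in sequentially. norm (xs k) \<le> \<kappa> * norm (ys k) + \<epsilon> k * (1 + \<kappa>)"
proof -
  obtain V W where VW: "open V" "xb \<in> V" "open W" "yb \<in> W"
    and bd: "\<And>\<epsilon> x y xs zs. \<epsilon> \<ge> 0 \<Longrightarrow> x \<in> V \<Longrightarrow> y \<in> W \<Longrightarrow>
       contingent_normal_pair S \<Omega> \<Theta> \<epsilon> x y xs zs \<Longrightarrow> norm xs \<le> \<kappa> * norm zs + \<epsilon> * (1 + \<kappa>)"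
    using lipschitz_like_normal_bound[OF lip] by blast
  have "\<forall>\<^sub>F k in sequentially. (x k, y k) \<in> V \<times> W"
    using VW by (intro topological_tendstoD[OF xy] open_Times) auto
  then show ?thesis
  proof eventually_elim
    case (elim k)
    have "\<epsilon> k \<ge> 0" using \<epsilon> by (simp add: decreases_to_0_def less_imp_le)
    from bd[OF this _ _ n[of k]] elim show ?case by simp
  qed
qed

lemma lipschitz_like_imp_psnc:
  assumes lip: "lipschitz_like_const S \<Omega> \<Theta> xb yb \<kappa>"
  shows "psnc S \<Omega> \<Theta> xb yb"
  unfolding psnc_def
proof (intro allI impI)
  fix \<epsilon> x y xs and ys :: "nat \<Rightarrow> ('b \<Rightarrow>\<^sub>L real)"
  assume \<epsilon>: "decreases_to_0 \<epsilon>" and xy: "(\<lambda>k. (x k, y k)) \<longlonglongrightarrow> (xb, yb)" and ys: "ys \<longlonglongrightarrow> 0"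
    and n: "\<forall>k. contingent_normal_pair S \<Omega> \<Theta> (\<epsilon> k) (x k) (y k) (xs k) (- ys k)"
  have \<epsilon>0: "\<epsilon> \<longlonglongrightarrow> 0" using \<epsilon> by (simp add: decreases_to_0_def)
  have "(\<lambda>k. \<kappa> * norm (ys k) + \<epsilon> k * (1 + \<kappa>)) \<longlonglongrightarrow> \<kappa> * norm (0 :: 'b \<Rightarrow>\<^sub>L real) + 0 * (1 + \<kappa>)"
    by (intro tendsto_add tendsto_mult_left tendsto_mult_right tendsto_norm ys \<epsilon>0)
  then have lim: "(\<lambda>k. \<kappa> * norm (ys k) + \<epsilon> k * (1 + \<kappa>)) \<longlonglongrightarrow> 0" by simp
  have "\<forall>\<^sub>F k in sequentially. norm (xs k) \<le> \<kappa> * norm (ys k) + \<epsilon> k * (1 + \<kappa>)"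
    using lipschitz_like_sequence_bound[OF lip \<epsilon> xy] n by blast
  then have "\<forall>\<^sub>F k in sequentially. norm (norm (xs k)) \<le> \<kappa> * norm (ys k) + \<epsilon> k * (1 + \<kappa>)" by simp
  from Lim_null_comparison[OF this lim] show "(\<lambda>k. norm (xs k)) \<longlonglongrightarrow> 0" .
qed

lemma lipschitz_like_mixed_bound:
  assumes lip: "lipschitz_like_const S \<Omega> \<Theta> xb yb \<kappa>"
    and x: "xsb \<in> mixed_coderivative S \<Omega> \<Theta> xb yb ysb"
  shows "norm xsb \<le> \<kappa> * norm ysb"
proof -
  obtain \<epsilon> x y xs ys where \<epsilon>: "decreases_to_0 \<epsilon>" and xy: "(\<lambda>k. (x k, y k)) \<longlonglongrightarrow> (xb, yb)"
    and xs: "weak_star_tendsto xs xsb" and ys: "ys \<longlonglongrightarrow> ysb"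
    and n: "\<And>k. contingent_normal_pair S \<Omega> \<Theta> (\<epsilon> k) (x k) (y k) (xs k) (- ys k)"
    using x unfolding mixed_coderivative_def by blast
  have \<epsilon>0: "\<epsilon> \<longlonglongrightarrow> 0" using \<epsilon> by (simp add: decreases_to_0_def)
  have "(\<lambda>k. \<kappa> * norm (ys k) + \<epsilon> k * (1 + \<kappa>)) \<longlonglongrightarrow> \<kappa> * norm ysb + 0 * (1 + \<kappa>)"
    by (intro tendsto_add tendsto_mult_left tendsto_mult_right tendsto_norm ys \<epsilon>0)
  from weak_star_norm_le[OF xs lipschitz_like_sequence_bound[OF lip \<epsilon> xy n] this]
  show ?thesis by simp
qed

lemma zero_in_mixed_coderivative:
  assumes "(xb, yb) \<in> gph (restr S \<Omega> \<Theta>)"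
  shows "0 \<in> mixed_coderivative S \<Omega> \<Theta> xb yb 0"
proof -
  have xy: "xb \<in> \<Omega>" "yb \<in> \<Theta>" using assms by (auto simp: mem_gph_restr)
  have d0: "dual_pair 0 (- 0) = (0 :: ('a \<times> 'b) \<Rightarrow>\<^sub>L real)"
    by (rule blinfun_eqI) (auto simp: dual_pair_apply)
  have "contingent_normal_pair S \<Omega> \<Theta> (inverse (real (Suc k))) xb yb 0 (- 0)" for k
    unfolding contingent_normal_pair_def d0
  proof (intro conjI assms)
    show "0 \<in> eps_normals (inverse (real (Suc k))) (xb, yb) (gph (restr S \<Omega> \<Theta>))"
      by (rule zero_eps_normal) simp
    show "0 \<in> (\<Union>v\<in>contingent_cone xb \<Omega>. duality_map v)"
      using xy(1) by (rule zero_in_duality_contingent_cone)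
    show "- 0 \<in> (\<Union>w\<in>contingent_cone yb \<Theta>. duality_map w)"
      using zero_in_duality_contingent_cone[OF xy(2)] by simp
  qed
  moreover have "decreases_to_0 (\<lambda>k. inverse (real (Suc k)))"
    using LIMSEQ_inverse_real_of_nat by (simp add: decreases_to_0_def)
  moreover have "weak_star_tendsto (\<lambda>k. 0) (0 :: 'a \<Rightarrow>\<^sub>L real)" by (simp add: weak_star_tendsto_def)
  ultimately show ?thesis
    unfolding mixed_coderivative_def
    by (intro CollectI exI[of _ "\<lambda>k. inverse (real (Suc k))"] exI[of _ "\<lambda>_. xb"] exI[of _ "\<lambda>_. yb"]
        exI[of _ "\<lambda>_. 0"]) auto
qed

lemma outer_norm_upper: "norm y \<le> 1 \<Longrightarrow> x \<in> H y \<Longrightarrow> ennreal (norm x) \<le> outer_norm H"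
  unfolding outer_norm_def by (rule SUP_upper2[of y]) (auto intro: SUP_upper)

lemma lipschitz_like_imp_outer_norm_le:
  assumes lip: "lipschitz_like_const S \<Omega> \<Theta> xb yb \<kappa>"
  shows "outer_norm (mixed_coderivative S \<Omega> \<Theta> xb yb) \<le> ennreal \<kappa>"
  unfolding outer_norm_def
proof (intro SUP_least)
  fix ys xs assume ys: "ys \<in> cball 0 1" and xs: "xs \<in> mixed_coderivative S \<Omega> \<Theta> xb yb ys"
  have "\<kappa> \<ge> 0" using lip by (simp add: lipschitz_like_const_def)
  then have "\<kappa> * norm ys \<le> \<kappa> * 1" using ys by (intro mult_left_mono) auto
  then show "ennreal (norm xs) \<le> ennreal \<kappa>"
    using lipschitz_like_mixed_bound[OF lip xs] by (intro ennreal_leI) simp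
qed

lemma mixed_coderivative_scale:
  assumes x: "xsb \<in> mixed_coderivative S \<Omega> \<Theta> xb yb ysb" and c: "c > 0"
  shows "c *\<^sub>R xsb \<in> mixed_coderivative S \<Omega> \<Theta> xb yb (c *\<^sub>R ysb)"
proof -
  obtain \<epsilon> x y xs ys where \<epsilon>: "decreases_to_0 \<epsilon>" and xy: "(\<lambda>k. (x k, y k)) \<longlonglongrightarrow> (xb, yb)"
    and xs: "weak_star_tendsto xs xsb" and ys: "ys \<longlonglongrightarrow> ysb"
    and n: "\<And>k. contingent_normal_pair S \<Omega> \<Theta> (\<epsilon> k) (x k) (y k) (xs k) (- ys k)"
    using x unfolding mixed_coderivative_def by blast
  have "decreases_to_0 (\<lambda>k. c * \<epsilon> k)"
    using \<epsilon> c tendsto_mult_left[of \<epsilon> 0 sequentially c] by (simp add: decreases_to_0_def)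
  moreover have "(\<lambda>k. c *\<^sub>R ys k) \<longlonglongrightarrow> c *\<^sub>R ysb" by (intro tendsto_scaleR tendsto_const ys)
  moreover have "contingent_normal_pair S \<Omega> \<Theta> (c * \<epsilon> k) (x k) (y k) (c *\<^sub>R xs k) (- (c *\<^sub>R ys k))" for k
    using contingent_normal_pair_scale[OF n[of k] c] by simp
  ultimately show ?thesis
    using xy weak_star_tendsto_scale[OF xs, of c] unfolding mixed_coderivative_def by blast
qed

lemma normal_coderivative_scale:
  assumes x: "xsb \<in> normal_coderivative S \<Omega> \<Theta> xb yb ysb" and c: "c > 0"
  shows "c *\<^sub>R xsb \<in> normal_coderivative S \<Omega> \<Theta> xb yb (c *\<^sub>R ysb)"
proof -
  obtain \<epsilon> x y xs ys where \<epsilon>: "decreases_to_0 \<epsilon>" and xy: "(\<lambda>k. (x k, y k)) \<longlonglongrightarrow> (xb, yb)"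
    and xs: "weak_star_tendsto xs xsb" and ys: "weak_star_tendsto ys ysb"
    and n: "\<And>k. contingent_normal_pair S \<Omega> \<Theta> (\<epsilon> k) (x k) (y k) (xs k) (- ys k)"
    using x unfolding normal_coderivative_def by blast
  have "decreases_to_0 (\<lambda>k. c * \<epsilon> k)"
    using \<epsilon> c tendsto_mult_left[of \<epsilon> 0 sequentially c] by (simp add: decreases_to_0_def)
  moreover have "contingent_normal_pair S \<Omega> \<Theta> (c * \<epsilon> k) (x k) (y k) (c *\<^sub>R xs k) (- (c *\<^sub>R ys k))" for k
    using contingent_normal_pair_scale[OF n[of k] c] by simp
  ultimately show ?thesis
    using xy weak_star_tendsto_scale[OF xs, of c] weak_star_tendsto_scale[OF ys, of c]
    unfolding normal_coderivative_def by blast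
qed

text \<open>The mixed coderivative is positively homogeneous, so a nonzero element of its value at \<open>0\<close> would
  produce elements of arbitrarily large norm there.\<close>

lemma finite_outer_norm_imp_zero:
  assumes fin: "outer_norm (mixed_coderivative S \<Omega> \<Theta> xb yb) < \<infinity>"
    and x: "xsb \<in> mixed_coderivative S \<Omega> \<Theta> xb yb 0"
  shows "xsb = 0"
proof (rule ccontr)
  assume ne: "xsb \<noteq> 0"
  obtain M where M: "outer_norm (mixed_coderivative S \<Omega> \<Theta> xb yb) = ennreal M" "M \<ge> 0"
    using fin by (auto simp: less_top_ennreal)
  define c where "c = (M + 1) / norm xsb"
  have c: "c > 0" using M ne by (simp add: c_def)
  have "c *\<^sub>R xsb \<in> mixed_coderivative S \<Omega> \<Theta> xb yb 0" using mixed_coderivative_scale[OF x c] by simp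
  then have "ennreal (norm (c *\<^sub>R xsb)) \<le> ennreal M"
    unfolding M(1)[symmetric] by (intro outer_norm_upper[of 0]) auto
  moreover have "norm (c *\<^sub>R xsb) = M + 1" using M(2) ne by (simp add: c_def)
  ultimately show False using M(2) by (simp add: ennreal_le_iff)
qed

section \<open>Contingent normals where the Lipschitz-like property fails\<close>

lemma sqrt_has_derivative:
  fixes \<psi> :: "'a::real_normed_vector \<Rightarrow> real"
  assumes "(\<psi> has_derivative \<psi>') (at p)" "\<psi> p > 0"
  shows "((\<lambda>q. sqrt (\<psi> q)) has_derivative (\<lambda>h. \<psi>' h / (2 * sqrt (\<psi> p)))) (at p)"
proof -
  have "(sqrt has_derivative (\<lambda>h. inverse (sqrt (\<psi> p)) / 2 * h)) (at (\<psi> p))"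
    using DERIV_real_sqrt[OF assms(2)] unfolding has_field_derivative_def .
  from has_derivative_compose[OF assms(1) this] show ?thesis
    by (simp add: field_simps)
qed

lemma in_scaled_unit_ball:
  fixes z :: "'a::real_normed_vector"
  assumes "norm z \<le> k"
  shows "z \<in> (\<lambda>b. k *\<^sub>R b) ` cball 0 1"
proof (cases "k = 0")
  case True
  then show ?thesis using assms by (intro image_eqI[of _ _ 0]) auto
next
  case False
  then have "k > 0" using assms norm_ge_zero[of z] by linarith
  then show ?thesis using assms by (intro image_eqI[of _ _ "(1 / k) *\<^sub>R z"]) auto
qed

lemma not_lipschitz_like_constD:
  assumes nlip: "\<not> lipschitz_like_const S \<Omega> \<Theta> xb yb \<kappa>" and \<kappa>: "\<kappa> \<ge> 0" and \<rho>: "\<rho> > 0"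
  shows "\<exists>x0\<in>\<Omega>. \<exists>x1\<in>\<Omega>. \<exists>y1\<in>S x1 \<inter> \<Theta>. norm (x0 - xb) < \<rho> \<and> norm (x1 - xb) < \<rho> \<and> norm (y1 - yb) < \<rho>
     \<and> x0 \<noteq> x1 \<and> (\<forall>v\<in>S x0 \<inter> \<Theta>. \<kappa> * norm (x1 - x0) < norm (v - y1))"
proof -
  have "\<not> (\<forall>x\<in>\<Omega> \<inter> ball xb \<rho>. \<forall>x'\<in>\<Omega> \<inter> ball xb \<rho>. (S x' \<inter> \<Theta>) \<inter> ball yb \<rho>
             \<subseteq> (S x \<inter> \<Theta>) + (\<lambda>b. (\<kappa> * norm (x' - x)) *\<^sub>R b) ` cball 0 1)"
  proof
    assume H: "\<forall>x\<in>\<Omega> \<inter> ball xb \<rho>. \<forall>x'\<in>\<Omega> \<inter> ball xb \<rho>. (S x' \<inter> \<Theta>) \<inter> ball yb \<rho>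
             \<subseteq> (S x \<inter> \<Theta>) + (\<lambda>b. (\<kappa> * norm (x' - x)) *\<^sub>R b) ` cball 0 1"
    have "lipschitz_like_const S \<Omega> \<Theta> xb yb \<kappa>"
      unfolding lipschitz_like_const_def
      by (intro conjI exI[of _ "ball xb \<rho>"] exI[of _ "ball yb \<rho>"] H \<kappa>) (use \<rho> in auto)
    with nlip show False by blast
  qed
  then obtain x0 x1 y1 where x: "x0 \<in> \<Omega> \<inter> ball xb \<rho>" "x1 \<in> \<Omega> \<inter> ball xb \<rho>"
    and y: "y1 \<in> S x1 \<inter> \<Theta> \<inter> ball yb \<rho>"
    and ny: "y1 \<notin> (S x0 \<inter> \<Theta>) + (\<lambda>b. (\<kappa> * norm (x1 - x0)) *\<^sub>R b) ` cball 0 1"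
    by blast
  have far: "\<kappa> * norm (x1 - x0) < norm (v - y1)" if v: "v \<in> S x0 \<inter> \<Theta>" for v
  proof (rule ccontr)
    let ?k = "\<kappa> * norm (x1 - x0)"
    assume "\<not> ?k < norm (v - y1)"
    then have le: "norm (y1 - v) \<le> ?k" by (simp add: norm_minus_commute)
    then have "y1 - v \<in> (\<lambda>b. ?k *\<^sub>R b) ` cball 0 1" by (rule in_scaled_unit_ball)
    from set_plus_intro[OF v this] ny show False by simp
  qed
  have "x0 \<noteq> x1" using far[of y1] y by auto
  then show ?thesis
    using x y far by (intro bexI[of _ x0] bexI[of _ x1] bexI[of _ y1]) (auto simp: dist_norm norm_minus_commute)
qed

text \<open>The failure of the Lipschitz-like property with a constant \<open>\<kappa>'\<close> yields points \<open>x0\<close>, \<open>x1\<close> near \<open>xb\<close>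
  and \<open>y1 \<in> S x1\<close> near \<open>yb\<close> such that no point of \<open>S x0 \<inter> \<Theta>\<close> is within \<open>\<kappa>' r\<close> of \<open>y1\<close>, where
  \<open>r = norm (x1 - x0)\<close>. The function
  \<open>g (u, v) = norm (u - x0) + (sqrt ((norm (v - y1))\<^sup>2 + \<eta>\<^sup>2) - \<eta>) / \<kappa>\<close> takes the value \<open>r\<close> at \<open>(x1, y1)\<close>.
  Ekeland's principle gives an almost minimiser \<open>(u, v)\<close> on the restricted graph with \<open>g (u, v) \<le> r\<close>,
  and the choice of \<open>\<eta>\<close> excludes \<open>u = x0\<close>. So the first summand is differentiable at \<open>(u, v)\<close> with a
  gradient of norm \<open>1\<close>, while the gradient of the second one, which is smoothed at \<open>v = y1\<close>, has norm
  at most \<open>1 / \<kappa>\<close>. The negative gradient is an \<open>e\<close>-normal whose components are images under the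
  duality mappings of nonnegative multiples of \<open>x0 - u\<close> and \<open>y1 - v\<close>; these are tangent directions
  because \<open>\<Omega>\<close> and \<open>\<Theta>\<close> are convex.\<close>

lemma not_lipschitz_like_normal_pair:
  fixes S :: "'a::banach \<Rightarrow> 'b::banach set"
  assumes lucX: "locally_uniformly_convex TYPE('a \<Rightarrow>\<^sub>L real)"
    and lucY: "locally_uniformly_convex TYPE('b \<Rightarrow>\<^sub>L real)"
    and conv: "convex \<Omega>" "convex \<Theta>"
    and cl: "closed_around (gph (restr S \<Omega> \<Theta>)) (xb, yb)"
    and nlip: "\<not> lipschitz_like_const S \<Omega> \<Theta> xb yb \<kappa>'"
    and \<kappa>: "0 < \<kappa>" "\<kappa> < \<kappa>'" and e: "e > 0"
  shows "\<exists>x y xs ys. dist (x, y) (xb, yb) < e \<and> contingent_normal_pair S \<Omega> \<Theta> e x y xs (- ys)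
     \<and> norm xs = 1 \<and> norm ys \<le> 1 / \<kappa>"
proof -
  let ?G = "gph (restr S \<Omega> \<Theta>)"
  obtain C where C: "(xb, yb) \<in> interior C" "closed (?G \<inter> C)"
    using cl unfolding closed_around_def by blast
  obtain m0 where m0: "m0 > 0" "ball (xb, yb) m0 \<subseteq> C" using C(1) unfolding mem_interior by blast
  define m where "m = min m0 e"
  have m: "m > 0" "m \<le> e" "ball (xb, yb) m \<subseteq> C" using m0 e by (auto simp: m_def)
  \<comment> \<open>Every \<open>(u, v)\<close> with \<open>norm (u - x0) \<le> r\<close> and \<open>norm (v - y1) \<le> \<kappa>' r\<close> stays within
      \<open>3 \<rho> + (2 \<kappa>' + 1) \<rho> = m\<close> of \<open>(xb, yb)\<close>, since \<open>r < 2 \<rho>\<close>.\<close>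
  define \<rho> where "\<rho> = m / (4 + 2 * \<kappa>')"
  have \<rho>: "\<rho> > 0" using m \<kappa> by (simp add: \<rho>_def)
  have \<rho>m: "(4 + 2 * \<kappa>') * \<rho> = m" using \<kappa> by (simp add: \<rho>_def)
  obtain x0 x1 y1 where x0: "x0 \<in> \<Omega>" "norm (x0 - xb) < \<rho>" and x1: "x1 \<in> \<Omega>" "norm (x1 - xb) < \<rho>"
    and y1: "y1 \<in> S x1" "y1 \<in> \<Theta>" "norm (y1 - yb) < \<rho>" and ne: "x0 \<noteq> x1"
    and far: "\<And>v. v \<in> S x0 \<Longrightarrow> v \<in> \<Theta> \<Longrightarrow> \<kappa>' * norm (x1 - x0) < norm (v - y1)"
    using not_lipschitz_like_constD[OF nlip _ \<rho>] \<kappa> by force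
  define r where "r = norm (x1 - x0)"
  have r: "r > 0" using ne by (simp add: r_def)
  have r2: "r < 2 * \<rho>"
    using norm_triangle_ineq4[of "x1 - xb" "x0 - xb"] x0 x1 by (simp add: r_def)
  \<comment> \<open>The value for which \<open>g (u, v) \<le> r\<close> implies \<open>norm (v - y1) \<le> \<kappa> r + \<eta> = \<kappa>' r\<close>.\<close>
  define \<eta> where "\<eta> = (\<kappa>' - \<kappa>) * r"
  have \<eta>: "\<eta> > 0" using \<kappa> r by (simp add: \<eta>_def)
  have near: "dist (u, v) (xb, yb) < m" if "norm (u - x0) \<le> r" "norm (v - y1) \<le> \<kappa>' * r" for u v
  proof -
    have "dist (u, v) (xb, yb) \<le> norm (u - xb) + norm (v - yb)"
      using norm_Pair_le[of "u - xb" "v - yb"] by (simp add: dist_norm)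
    moreover have "norm (u - xb) \<le> norm (u - x0) + norm (x0 - xb)"
      using norm_triangle_ineq[of "u - x0" "x0 - xb"] by simp
    moreover have "norm (v - yb) \<le> norm (v - y1) + norm (y1 - yb)"
      using norm_triangle_ineq[of "v - y1" "y1 - yb"] by simp
    moreover have "\<kappa>' * r \<le> \<kappa>' * (2 * \<rho>)" using r2 \<kappa> by (intro mult_left_mono) auto
    ultimately show ?thesis using that x0 x1 y1 r2 \<rho>m by (simp add: algebra_simps)
  qed
  define g where "g q = norm (fst q - x0) + (sqrt ((norm (snd q - y1))\<^sup>2 + \<eta>\<^sup>2) - \<eta>) / \<kappa>" for q
  have pos: "(norm b)\<^sup>2 + \<eta>\<^sup>2 > 0" for b :: 'b using \<eta> by (intro add_nonneg_pos) auto
  have sq: "norm b \<le> sqrt ((norm b)\<^sup>2 + \<eta>\<^sup>2)" "\<eta> \<le> sqrt ((norm b)\<^sup>2 + \<eta>\<^sup>2)" for b :: 'b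
    by (auto intro!: real_le_rsqrt)
  have "(x1, y1) \<in> ?G \<inter> C"
    using x1 y1 m(3) near[of x1 y1] r \<kappa> by (auto simp: mem_gph_restr r_def dist_commute subset_iff)
  moreover have "continuous_on (?G \<inter> C) g"
    unfolding g_def using \<kappa> by (intro continuous_intros) auto
  moreover have "g q \<ge> 0" for q unfolding g_def using \<kappa> sq by (intro add_nonneg_nonneg divide_nonneg_pos) auto
  ultimately obtain p where p: "p \<in> ?G \<inter> C" "g p + e * dist (x1, y1) p \<le> g (x1, y1)"
    and min: "\<And>q. q \<in> ?G \<inter> C \<Longrightarrow> g p \<le> g q + e * dist p q"
    using ekeland[OF C(2), of "(x1, y1)" g e] e by blast
  obtain u v where uv: "p = (u, v)" by (cases p)
  have G: "u \<in> \<Omega>" "v \<in> S u" "v \<in> \<Theta>" using p(1) uv by (auto simp: mem_gph_restr)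
  define s where "s = sqrt ((norm (v - y1))\<^sup>2 + \<eta>\<^sup>2)"
  have s: "s > 0" "norm (v - y1) \<le> s" "\<eta> \<le> s" using sq[of "v - y1"] pos[of "v - y1"] by (simp_all add: s_def)
  have "g (x1, y1) = r" using \<eta> by (simp add: g_def r_def)
  moreover have "0 \<le> e * dist (x1, y1) p" using e by simp
  ultimately have "g p \<le> r" using p(2) by linarith
  then have gp: "norm (u - x0) + (s - \<eta>) / \<kappa> \<le> r" by (simp add: uv g_def s_def)
  have "(s - \<eta>) / \<kappa> \<ge> 0" using s \<kappa> by simp
  then have ur: "norm (u - x0) \<le> r" using gp by simp
  have "(s - \<eta>) / \<kappa> \<le> r" using gp norm_ge_zero[of "u - x0"] by linarith
  then have "s \<le> \<kappa>' * r" using \<kappa> by (simp add: \<eta>_def field_simps)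
  then have vr: "norm (v - y1) \<le> \<kappa>' * r" using s by simp
  have ux: "u \<noteq> x0" using far[of v] G vr by (auto simp: r_def)
  have dist: "dist (u, v) (xb, yb) < m" using near[OF ur vr] .
  have "p \<in> interior C" using dist m(3) interior_maximal[OF m(3)] by (auto simp: uv dist_commute)
  obtain F where F: "F \<in> duality_map (u - x0)"
    "((\<lambda>z. (norm z)\<^sup>2) has_derivative (\<lambda>h. 2 * blinfun_apply F h)) (at (u - x0))"
    using norm_sq_has_derivative[OF lucX] by blast
  obtain H where H: "H \<in> duality_map (v - y1)"
    "((\<lambda>z. (norm z)\<^sup>2) has_derivative (\<lambda>h. 2 * blinfun_apply H h)) (at (v - y1))"
    using norm_sq_has_derivative[OF lucY] by blast
  define ys where "ys = (1 / (\<kappa> * s)) *\<^sub>R H"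
  define xs where "xs = (1 / norm (u - x0)) *\<^sub>R (- F)"
  have "((\<lambda>q. fst q - x0) has_derivative fst) (at p)" "((\<lambda>q. snd q - y1) has_derivative snd) (at p)"
    by (auto intro!: derivative_eq_intros)
  then have "((\<lambda>q. (norm (fst q - x0))\<^sup>2) has_derivative (\<lambda>h. 2 * blinfun_apply F (fst h))) (at p)"
    and "((\<lambda>q. (norm (snd q - y1))\<^sup>2) has_derivative (\<lambda>h. 2 * blinfun_apply H (snd h))) (at p)"
    using has_derivative_compose[of "\<lambda>q. fst q - x0" fst p UNIV] F(2)
      has_derivative_compose[of "\<lambda>q. snd q - y1" snd p UNIV] H(2) by (auto simp: uv)
  then have "((\<lambda>q. sqrt ((norm (fst q - x0))\<^sup>2)) has_derivative
      (\<lambda>h. 2 * blinfun_apply F (fst h) / (2 * sqrt ((norm (fst p - x0))\<^sup>2)))) (at p)"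
    and "((\<lambda>q. sqrt ((norm (snd q - y1))\<^sup>2 + \<eta>\<^sup>2)) has_derivative
      (\<lambda>h. 2 * blinfun_apply H (snd h) / (2 * sqrt ((norm (snd p - y1))\<^sup>2 + \<eta>\<^sup>2)))) (at p)"
    using ux pos by (intro sqrt_has_derivative has_derivative_add_const; simp add: uv)+
  then have d1: "((\<lambda>q. norm (fst q - x0)) has_derivative (\<lambda>h. blinfun_apply F (fst h) / norm (u - x0))) (at p)"
    and d2: "((\<lambda>q. sqrt ((norm (snd q - y1))\<^sup>2 + \<eta>\<^sup>2)) has_derivative (\<lambda>h. blinfun_apply H (snd h) / s)) (at p)"
    by (simp_all add: uv s_def)
  have "((\<lambda>q. norm (fst q - x0) + (1 / \<kappa>) * (sqrt ((norm (snd q - y1))\<^sup>2 + \<eta>\<^sup>2) - \<eta>)) has_derivative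
      (\<lambda>h. blinfun_apply F (fst h) / norm (u - x0) + (1 / \<kappa>) * (blinfun_apply H (snd h) / s - 0))) (at p)"
    by (intro has_derivative_add has_derivative_mult_right has_derivative_diff has_derivative_const d1 d2)
  moreover have "(\<lambda>h. blinfun_apply F (fst h) / norm (u - x0) + (1 / \<kappa>) * (blinfun_apply H (snd h) / s - 0))
      = blinfun_apply (dual_pair (- xs) ys)"
    by (auto simp: fun_eq_iff dual_pair_apply xs_def ys_def blinfun.scaleR_left blinfun.minus_left)
  moreover have "(\<lambda>q. norm (fst q - x0) + (1 / \<kappa>) * (sqrt ((norm (snd q - y1))\<^sup>2 + \<eta>\<^sup>2) - \<eta>)) = g"
    by (simp add: g_def fun_eq_iff)
  ultimately have "(g has_derivative blinfun_apply (dual_pair (- xs) ys)) (at p)" by simp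
  then have "- dual_pair (- xs) ys \<in> eps_normals e p ?G"
    using \<open>p \<in> interior C\<close> by (rule perturbed_minimum_eps_normal) (use min in \<open>simp add: dist_norm norm_minus_commute\<close>)
  then have normal: "dual_pair xs (- ys) \<in> eps_normals e (u, v) ?G" by (simp add: dual_pair_minus uv)
  have "- F \<in> duality_map (x0 - u)" using duality_map_minus[OF F(1)] by simp
  then have "xs \<in> duality_map ((1 / norm (u - x0)) *\<^sub>R (x0 - u))"
    unfolding xs_def by (rule duality_map_scale) simp
  moreover have "(1 / norm (u - x0)) *\<^sub>R (x0 - u) \<in> contingent_cone u \<Omega>"
    using conv(1) G(1) x0(1) by (intro convex_contingent_cone) auto
  moreover have "- H \<in> duality_map (y1 - v)" using duality_map_minus[OF H(1)] by simp
  then have "(1 / (\<kappa> * s)) *\<^sub>R (- H) \<in> duality_map ((1 / (\<kappa> * s)) *\<^sub>R (y1 - v))"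
    by (rule duality_map_scale) (use \<kappa> s in simp)
  then have "- ys \<in> duality_map ((1 / (\<kappa> * s)) *\<^sub>R (y1 - v))" by (simp add: ys_def)
  moreover have "(1 / (\<kappa> * s)) *\<^sub>R (y1 - v) \<in> contingent_cone v \<Theta>"
    using conv(2) G(3) y1(2) \<kappa> s by (intro convex_contingent_cone) auto
  ultimately have "contingent_normal_pair S \<Omega> \<Theta> e u v xs (- ys)"
    using normal p(1) unfolding contingent_normal_pair_def uv by blast
  moreover have "norm xs = 1" using F(1) ux by (simp add: xs_def duality_map_def)
  moreover have "norm ys \<le> 1 / \<kappa>"
    using H(1) s \<kappa> by (simp add: ys_def duality_map_def field_simps)
  ultimately show ?thesis using dist m(2) by (intro exI[of _ u] exI[of _ v] exI[of _ xs] exI[of _ ys]) auto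
qed

text \<open>The constants may vary along the sequence: they tend to infinity in the proof of the Lipschitz-like
  property and are fixed in the estimate of the modulus. The index \<open>r k\<close> records the passage to a
  weak-star convergent subsequence.\<close>

lemma not_lipschitz_like_normal_sequence:
  fixes S :: "'a::banach \<Rightarrow> 'b::banach set"
  assumes X: "reflexive_banach_luc TYPE('a)" and Y: "reflexive_banach_luc TYPE('b)"
    and conv: "convex \<Omega>" "convex \<Theta>"
    and cl: "closed_around (gph (restr S \<Omega> \<Theta>)) (xb, yb)"
    and nlip: "\<And>k. \<not> lipschitz_like_const S \<Omega> \<Theta> xb yb (\<kappa>' k)"
    and \<kappa>: "\<And>k::nat. 0 < \<kappa> k" "\<And>k. \<kappa> k < \<kappa>' k"
  shows "\<exists>r \<epsilon> x y xs ys xsb. strict_mono (r :: nat \<Rightarrow> nat) \<and> decreases_to_0 \<epsilon> \<and> (\<forall>k. \<epsilon> k < 1)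
     \<and> (\<lambda>k. (x k, y k)) \<longlonglongrightarrow> (xb, yb) \<and> weak_star_tendsto xs xsb
     \<and> (\<forall>k. contingent_normal_pair S \<Omega> \<Theta> (\<epsilon> k) (x k) (y k) (xs k) (- ys k))
     \<and> (\<forall>k. norm (xs k) = 1) \<and> (\<forall>k. norm (ys k) \<le> 1 / \<kappa> (r k))"
proof -
  define e where "e k = inverse (real (Suc (Suc k)))" for k
  have e: "e k > 0" "e k < 1" for k by (auto simp: e_def field_simps)
  have e0: "e \<longlonglongrightarrow> 0" unfolding e_def by (rule LIMSEQ_Suc[OF LIMSEQ_inverse_real_of_nat])
  have "\<exists>x y xs ys. dist (x, y) (xb, yb) < e k \<and> contingent_normal_pair S \<Omega> \<Theta> (e k) x y xs (- ys)
     \<and> norm xs = 1 \<and> norm ys \<le> 1 / \<kappa> k" for k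
    using X Y nlip[of k] \<kappa>[of k] e(1)[of k] unfolding reflexive_banach_luc_def
    by (intro not_lipschitz_like_normal_pair[OF _ _ conv cl]) auto
  then obtain x y xs ys where s: "\<And>k. dist (x k, y k) (xb, yb) < e k"
    "\<And>k. contingent_normal_pair S \<Omega> \<Theta> (e k) (x k) (y k) (xs k) (- ys k)"
    "\<And>k. norm (xs k) = 1" "\<And>k. norm (ys k) \<le> 1 / \<kappa> k"
    by metis
  obtain r xsb where r: "strict_mono r" "weak_star_tendsto (xs \<circ> r) xsb"
    using bounded_seq_weak_star_subseq[of xs 1] X s(3) unfolding reflexive_banach_luc_def by auto
  have "(\<lambda>k. dist (x k, y k) (xb, yb)) \<longlonglongrightarrow> 0"
    by (rule tendsto_sandwich[OF _ _ tendsto_const e0]) (use s(1) in \<open>auto intro!: always_eventually less_imp_le\<close>)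
  then have xy: "(\<lambda>k. (x k, y k)) \<longlonglongrightarrow> (xb, yb)" by (subst tendsto_dist_iff)
  have "decreases_to_0 (e \<circ> r)"
    using e(1) LIMSEQ_subseq_LIMSEQ[OF e0 r(1)] by (simp add: decreases_to_0_def o_def)
  moreover have "(\<lambda>k. ((x \<circ> r) k, (y \<circ> r) k)) \<longlonglongrightarrow> (xb, yb)"
    using LIMSEQ_subseq_LIMSEQ[OF xy r(1)] by (simp add: o_def)
  ultimately show ?thesis
    using r s(2-4) e(2)
    by (intro exI[of _ r] exI[of _ "e \<circ> r"] exI[of _ "x \<circ> r"] exI[of _ "y \<circ> r"] exI[of _ "xs \<circ> r"]
        exI[of _ "ys \<circ> r"] exI[of _ xsb] conjI allI) simp_all
qed

text \<open>If the property fails for every constant, the functionals \<open>ys k\<close> tend to \<open>0\<close> while \<open>norm (xs k) = 1\<close>.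
  The weak-star limit of \<open>xs\<close> then lies in the mixed coderivative at \<open>0\<close>, so it is \<open>0\<close>, and the PSNC
  property contradicts \<open>norm (xs k) = 1\<close>.\<close>

lemma psnc_imp_lipschitz_like:
  fixes S :: "'a::banach \<Rightarrow> 'b::banach set"
  assumes X: "reflexive_banach_luc TYPE('a)" and Y: "reflexive_banach_luc TYPE('b)"
    and conv: "convex \<Omega>" "convex \<Theta>"
    and cl: "closed_around (gph (restr S \<Omega> \<Theta>)) (xb, yb)"
    and psnc: "psnc S \<Omega> \<Theta> xb yb" and mixed: "mixed_coderivative S \<Omega> \<Theta> xb yb 0 = {0}"
  shows "\<exists>\<kappa>. lipschitz_like_const S \<Omega> \<Theta> xb yb \<kappa>"
proof (rule ccontr)
  assume "\<not> ?thesis"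
  then have nlip: "\<not> lipschitz_like_const S \<Omega> \<Theta> xb yb (real (Suc (Suc k)))" for k by blast
  have pos: "0 < real (Suc k)" and less: "real (Suc k) < real (Suc (Suc k))" for k by auto
  obtain r :: "nat \<Rightarrow> nat" and \<epsilon> x y xs ys xsb where r: "strict_mono r" and \<epsilon>: "decreases_to_0 \<epsilon>"
    "\<And>k. \<epsilon> k < 1" and xy: "(\<lambda>k. (x k, y k)) \<longlonglongrightarrow> (xb, yb)" and xs: "weak_star_tendsto xs xsb"
    and n: "\<And>k. contingent_normal_pair S \<Omega> \<Theta> (\<epsilon> k) (x k) (y k) (xs k) (- ys k)"
    and nx: "\<And>k. norm (xs k) = 1" and ny: "\<And>k. norm (ys k) \<le> 1 / real (Suc (r k))"
    using not_lipschitz_like_normal_sequence[where \<kappa> = "\<lambda>k. real (Suc k)"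
        and \<kappa>' = "\<lambda>k. real (Suc (Suc k))", OF X Y conv cl nlip pos less] by blast
  have "(\<lambda>k. inverse (real (Suc (r k)))) \<longlonglongrightarrow> 0"
    using LIMSEQ_subseq_LIMSEQ[OF LIMSEQ_inverse_real_of_nat r] by (simp add: o_def)
  then have ys: "ys \<longlonglongrightarrow> 0"
    by (rule Lim_null_comparison[rotated]) (use ny in \<open>simp add: inverse_eq_divide\<close>)
  then have "xsb \<in> mixed_coderivative S \<Omega> \<Theta> xb yb 0"
    unfolding mixed_coderivative_def using \<epsilon>(1) xy xs n by blast
  then have "xsb = 0" using mixed by simp
  have "(\<lambda>k. norm (xs k)) \<longlonglongrightarrow> 0"
    using psnc[unfolded psnc_def, rule_format, of \<epsilon> x y xs ys] \<epsilon> xy xs ys n \<open>xsb = 0\<close>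
    by (simp add: decreases_to_0_def)
  then show False by (simp add: nx LIMSEQ_const_iff)
qed

text \<open>For a constant below the modulus the sequence \<open>ys\<close> is only bounded by \<open>1 / \<kappa>\<close>, hence the passage to
  a weak-star limit and to the normal coderivative. Finite dimension of the domain space makes \<open>xs\<close>
  converge in norm, so that the limit keeps the norm \<open>1\<close>; scaling by \<open>\<kappa>\<close> puts the argument into the
  unit ball and gives an element of norm \<open>\<kappa>\<close>.\<close>

lemma lip_modulus_le_outer_norm:
  fixes S :: "'a::banach \<Rightarrow> 'b::banach set"
  assumes X: "reflexive_banach_luc TYPE('a)" and Y: "reflexive_banach_luc TYPE('b)"
    and conv: "convex \<Omega>" "convex \<Theta>"
    and cl: "closed_around (gph (restr S \<Omega> \<Theta>)) (xb, yb)"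
    and fin: "finite_dimensional TYPE('a)"
  shows "lip_modulus S \<Omega> \<Theta> xb yb \<le> outer_norm (normal_coderivative S \<Omega> \<Theta> xb yb)"
proof (rule ccontr)
  let ?N = "outer_norm (normal_coderivative S \<Omega> \<Theta> xb yb)"
  assume "\<not> ?thesis"
  \<comment> \<open>Two constants are needed between the outer norm and the modulus: the property fails for the
      larger one, and the normals obtained from that failure have \<open>norm (ys k)\<close> at most the
      reciprocal of the smaller one.\<close>
  then obtain c where c: "?N < c" "c < lip_modulus S \<Omega> \<Theta> xb yb" using dense[of ?N] by force
  obtain c' where c': "c < c'" "c' < lip_modulus S \<Omega> \<Theta> xb yb" using dense[OF c(2)] by blast
  obtain \<kappa>' where \<kappa>': "c' = ennreal \<kappa>'" "\<kappa>' \<ge> 0" using c'(2) by (cases c') auto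
  obtain \<kappa> where \<kappa>: "c = ennreal \<kappa>" "\<kappa> \<ge> 0" using c(2) by (cases c) auto
  have pos: "0 < \<kappa>" using c(1) \<kappa> by (metis ennreal_0 less_le not_less_zero)
  have less: "\<kappa> < \<kappa>'" using c'(1) \<kappa> \<kappa>' by (simp add: ennreal_less_iff)
  have nlip: "\<not> lipschitz_like_const S \<Omega> \<Theta> xb yb \<kappa>'"
  proof
    assume "lipschitz_like_const S \<Omega> \<Theta> xb yb \<kappa>'"
    then have "lip_modulus S \<Omega> \<Theta> xb yb \<le> ennreal \<kappa>'" unfolding lip_modulus_def by (intro INF_lower) simp
    then show False using c'(2) \<kappa>'(1) by simp
  qed
  obtain r :: "nat \<Rightarrow> nat" and \<epsilon> x y xs ys xsb where \<epsilon>: "decreases_to_0 \<epsilon>"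
    and xy: "(\<lambda>k. (x k, y k)) \<longlonglongrightarrow> (xb, yb)" and xs: "weak_star_tendsto xs xsb"
    and n: "\<And>k. contingent_normal_pair S \<Omega> \<Theta> (\<epsilon> k) (x k) (y k) (xs k) (- ys k)"
    and nx: "\<And>k. norm (xs k) = 1" and ny: "\<And>k. norm (ys k) \<le> 1 / \<kappa>"
    using not_lipschitz_like_normal_sequence[OF X Y conv cl nlip pos less] by blast
  obtain q ysb where q: "strict_mono q" "weak_star_tendsto (ys \<circ> q) ysb"
    using bounded_seq_weak_star_subseq[of ys "1 / \<kappa>"] ny Y unfolding reflexive_banach_luc_def by blast
  have "norm ysb \<le> 1 / \<kappa>" by (rule weak_star_norm_le[OF q(2) _ tendsto_const]) (use ny in simp)
  have "xs \<longlonglongrightarrow> xsb" by (rule weak_star_imp_norm_tendsto_finite_dimensional[OF fin xs])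
  then have "(\<lambda>k. norm (xs k)) \<longlonglongrightarrow> norm xsb" by (rule tendsto_norm)
  then have nxsb: "norm xsb = 1" by (simp add: nx LIMSEQ_const_iff)
  have "decreases_to_0 (\<epsilon> \<circ> q)"
    using \<epsilon> LIMSEQ_subseq_LIMSEQ[OF _ q(1)] by (auto simp: decreases_to_0_def)
  moreover have "(\<lambda>k. ((x \<circ> q) k, (y \<circ> q) k)) \<longlonglongrightarrow> (xb, yb)"
    using LIMSEQ_subseq_LIMSEQ[OF xy q(1)] by (simp add: o_def)
  moreover have "contingent_normal_pair S \<Omega> \<Theta> ((\<epsilon> \<circ> q) k) ((x \<circ> q) k) ((y \<circ> q) k) ((xs \<circ> q) k) (- (ys \<circ> q) k)" for k
    using n[of "q k"] by simp
  ultimately have "xsb \<in> normal_coderivative S \<Omega> \<Theta> xb yb ysb"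
    unfolding normal_coderivative_def using weak_star_tendsto_subseq[OF xs q(1)] q(2) by blast
  then have "\<kappa> *\<^sub>R xsb \<in> normal_coderivative S \<Omega> \<Theta> xb yb (\<kappa> *\<^sub>R ysb)"
    using pos by (rule normal_coderivative_scale)
  moreover have "norm (\<kappa> *\<^sub>R ysb) \<le> 1" using \<open>norm ysb \<le> 1 / \<kappa>\<close> pos by (simp add: field_simps)
  ultimately have "ennreal (norm (\<kappa> *\<^sub>R xsb)) \<le> ?N" by (intro outer_norm_upper)
  then show False using c(1) \<kappa>(1) pos nxsb by simp
qed

section \<open>Characterization of the relative Lipschitz-like property\<close>

theorem theorem3p8:
  fixes S :: "'a::banach \<Rightarrow> 'b::banach set"
    and \<Omega> :: "'a set" and \<Theta> :: "'b set" and xb :: 'a and yb :: 'b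
  assumes "reflexive_banach_luc TYPE('a)" and "reflexive_banach_luc TYPE('b)"
    and "closed \<Omega>" and "convex \<Omega>" and "closed \<Theta>" and "convex \<Theta>"
    and "(xb, yb) \<in> gph (restr S \<Omega> \<Theta>)"
    and "closed_around (gph (restr S \<Omega> \<Theta>)) (xb, yb)"
  shows "(lipschitz_like S \<Omega> \<Theta> xb yb
            \<longleftrightarrow> psnc S \<Omega> \<Theta> xb yb \<and> outer_norm (mixed_coderivative S \<Omega> \<Theta> xb yb) < \<infinity>)
       \<and> (lipschitz_like S \<Omega> \<Theta> xb yb
            \<longleftrightarrow> psnc S \<Omega> \<Theta> xb yb \<and> mixed_coderivative S \<Omega> \<Theta> xb yb 0 = {0})
       \<and> (lipschitz_like S \<Omega> \<Theta> xb yb \<longrightarrow>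
            outer_norm (mixed_coderivative S \<Omega> \<Theta> xb yb) \<le> lip_modulus S \<Omega> \<Theta> xb yb
            \<and> (finite_dimensional TYPE('a) \<longrightarrow>
                 lip_modulus S \<Omega> \<Theta> xb yb \<le> outer_norm (normal_coderivative S \<Omega> \<Theta> xb yb))
            \<and> (finite_dimensional TYPE('a) \<and> coderivatively_normal S \<Omega> \<Theta> xb yb \<longrightarrow>
                 lip_modulus S \<Omega> \<Theta> xb yb = outer_norm (mixed_coderivative S \<Omega> \<Theta> xb yb)
                 \<and> outer_norm (mixed_coderivative S \<Omega> \<Theta> xb yb)
                     = outer_norm (normal_coderivative S \<Omega> \<Theta> xb yb)))"
proof -
  let ?L = "lipschitz_like S \<Omega> \<Theta> xb yb" and ?P = "psnc S \<Omega> \<Theta> xb yb"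
  let ?M = "mixed_coderivative S \<Omega> \<Theta> xb yb" and ?N = "normal_coderivative S \<Omega> \<Theta> xb yb"
  let ?lip = "lip_modulus S \<Omega> \<Theta> xb yb"
  have i_ii: "?P \<and> outer_norm ?M < \<infinity>" if "?L"
  proof -
    obtain \<kappa> where "lipschitz_like_const S \<Omega> \<Theta> xb yb \<kappa>"
      using \<open>?L\<close> unfolding lipschitz_like_def by blast
    from lipschitz_like_imp_psnc[OF this] lipschitz_like_imp_outer_norm_le[OF this]
    show ?thesis by (auto intro: le_less_trans)
  qed
  have ii_iii: "?M 0 = {0}" if "outer_norm ?M < \<infinity>"
    using finite_outer_norm_imp_zero[OF that] zero_in_mixed_coderivative[OF assms(7)] by blast
  have iii_i: "?L" if "?P" "?M 0 = {0}"
    using psnc_imp_lipschitz_like[OF assms(1,2,4,6,8) that] assms(8) by (simp add: lipschitz_like_def)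
  have lower: "outer_norm ?M \<le> ?lip"
    unfolding lip_modulus_def by (rule INF_greatest) (simp add: lipschitz_like_imp_outer_norm_le)
  have upper: "?lip \<le> outer_norm ?N" if "finite_dimensional TYPE('a)"
    using lip_modulus_le_outer_norm[OF assms(1,2,4,6,8) that] .
  have "?lip = outer_norm ?M \<and> outer_norm ?M = outer_norm ?N"
    if "finite_dimensional TYPE('a)" "coderivatively_normal S \<Omega> \<Theta> xb yb"
    using lower upper[OF that(1)] that(2) by (simp add: coderivatively_normal_def)
  with i_ii ii_iii iii_i lower upper show ?thesis by blast
qed

end
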